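(* Let $a\ge b\ge c\ge 0$ be integers with $a\ge 1$, let $p$ be a prime, let $f=x^ay^b(x+y)^c\in\mathbb{F}_p[x,y]_{(x,y)}$, and let $\psi_p(t)=s(\mathbb{F}_p[x,y]_{(x,y)},f^t)$. Then for every integer $r$ with $0<\frac rp<\min\left\{\frac1a,\frac{2}{a+b+c}\right\}$, $$\psi_p\!\left(\frac rp\right)=\begin{cases}1-(a+b+c)\dfrac rp+a(b+c)\dfrac{r^2}{p^2} & \text{if } a\ge b+c,\\[2mm] 1-(a+b+c)\dfrac rp+\dfrac1{p^2}\left\lfloor\dfrac{(a+b+c)^2r^2}{4}\right\rfloor & \text{if } a<b+c.\end{cases}$$
   Context: For $R=\mathbb{F}_p[x,y]_{(x,y)}$, a nonzero $f\in(x,y)$ and real $t\ge0$, the $F$-signature of the pair $(R,f^t)$ is $$s(R,f^t)=\lim_{e\to\infty}\frac{1}{p^{2e}}\,\ell\!\left(\frac{R}{(x^{p^e},y^{p^e}):f^{\lceil tp^e\rceil}}\right),$$ where $\ell$ denotes length. *)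

theory Defs
  imports
    "HOL-Algebra.QuotRing"
    "HOL-Algebra.Module"
    "HOL-Algebra.Algebraic_Closure_Type"
    "HOL-Computational_Algebra.Fraction_Field"
    "HOL-Library.Extended_Real"
    "Berlekamp_Zassenhaus.Finite_Field"
begin

section \<open>Length of a module\<close>

text \<open>The length is the supremum of all \<open>n\<close> for which there is a strict chain
  \<open>N 0 \<subset> N 1 \<subset> \<dots> \<subset> N n\<close> of submodules; it is infinite if such chains are unbounded.\<close>

definition module_length ::
    "('a, 'c) ring_scheme \<Rightarrow> ('a, 'b, 'd) module_scheme \<Rightarrow> enat" where
  "module_length R M =
     (SUP n \<in> {n. \<exists>N. (\<forall>i\<le>n. submodule (N i) R M) \<and> (\<forall>i<n. N i \<subset> N (Suc i))}. enat n)"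

text \<open>The quotient ring \<open>R Quot I\<close> as an \<open>R\<close>-module, \<open>R\<close> acting through \<open>r \<mapsto> I +> r\<close>.\<close>

definition quotient_module ::
    "('a, 'c) ring_scheme \<Rightarrow> 'a set \<Rightarrow> ('a, 'a set) module" where
  "quotient_module R I =
     ring.extend (R Quot I)
       (module.fields (\<lambda>r A. rcoset_mult R I (I +>\<^bsub>R\<^esub> r) A))"

definition colon_ideal :: "('a, 'c) ring_scheme \<Rightarrow> 'a set \<Rightarrow> 'a \<Rightarrow> 'a set" where
  "colon_ideal R I g = {r \<in> carrier R. r \<otimes>\<^bsub>R\<^esub> g \<in> I}"


section \<open>The local ring of the affine plane at the origin\<close>

text \<open>\<open>k[x,y]\<close> is rendered as \<open>'k poly poly\<close>: the inner variable is \<open>x\<close>, the outer one is \<open>y\<close>.\<close>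

definition poly_x :: "'k::field poly poly" where
  "poly_x = [:[:0, 1:]:]"

definition poly_y :: "'k::field poly poly" where
  "poly_y = [:0, 1:]"

definition origin_ideal :: "'k::field poly poly set" where
  "origin_ideal = Idl\<^bsub>ring_of_type_algebra\<^esub> {poly_x, poly_y}"

text \<open>Localization of an integral domain at (the complement of) a prime ideal \<open>P\<close>, as a subring
  of the fraction field. The ring operations are those of the type \<open>'a fract\<close>.\<close>

definition localization_at :: "'a::idom set \<Rightarrow> 'a fract ring" where
  "localization_at P = ring_of_type_algebra\<lparr>carrier := {Fract g h | g h. h \<notin> P}\<rparr>"

definition plane_local_ring :: "'k::field poly poly fract ring" where
  "plane_local_ring = localization_at origin_ideal"

definition loc_x :: "'k::field poly poly fract" where
  "loc_x = Fract poly_x 1"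

definition loc_y :: "'k::field poly poly fract" where
  "loc_y = Fract poly_y 1"


section \<open>F-signature of a pair\<close>

text \<open>The type parameter \<open>'p\<close> carries the prime \<open>p = CARD('p)\<close>, and \<open>'p mod_ring\<close> is the
  field with \<open>p\<close> elements. Lengths may a priori be infinite, so the sequence and its limit
  are taken in the extended reals.\<close>

definition F_signature_seq ::
    "'p::prime_card mod_ring poly poly fract \<Rightarrow> real \<Rightarrow> nat \<Rightarrow> ereal" where
  "F_signature_seq f t e =
     (let R = plane_local_ring; p = CARD('p);
          I = Idl\<^bsub>R\<^esub> {loc_x ^ (p ^ e), loc_y ^ (p ^ e)};
          J = colon_ideal R I (f ^ nat \<lceil>t * real p ^ e\<rceil>)
      in ereal_of_enat (module_length R (quotient_module R J)) / ereal (real p ^ (2 * e)))"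

definition F_signature :: "'p::prime_card mod_ring poly poly fract \<Rightarrow> real \<Rightarrow> ereal" where
  "F_signature f t = lim (F_signature_seq f t)"

end

theory Submission
  imports Defs
begin

text \<open>Put \<open>q = p\<^sup>e = p Q\<close>, so that \<open>f\<close> is raised to the power \<open>r Q\<close>, and let \<open>A = a r\<close>, \<open>B = b r\<close>,
  \<open>C = c r\<close>, \<open>d = A + B + C\<close>. Over a finite field with \<open>p\<close> elements the length of \<open>R/J\<close> is read
  off its cardinality \<open>p\<^sup>N\<close>: Lagrange's theorem bounds every chain of submodules, and socle
  elements produce a chain of length \<open>N\<close>.

  Since \<open>(x + y)\<^sup>Q = x\<^sup>Q + y\<^sup>Q\<close>, multiplication by \<open>f\<close> raised to \<open>r Q\<close> acts on the \<open>Q\<^sup>2\<close> residue classes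
  of exponents modulo \<open>Q\<close> separately, and on each of them like \<open>x\<^sup>A y\<^sup>B (x + y)\<^sup>C\<close> modulo
  \<open>(x\<^sup>p, y\<^sup>p)\<close>. Setting \<open>y = 1\<close>, in degree \<open>n\<close> one has to find the rank of the map that sends a
  polynomial \<open>u\<close> of degree at most \<open>n\<close> to certain coefficients of \<open>t\<^sup>A (1 + t)\<^sup>C u\<close>. All these ranks
  follow from the bijectivity of one square map: polynomials of degree less than \<open>m\<close> to the
  coefficients with indices \<open>p - m, \<dots>, p - 1\<close>. For \<open>A \<ge> B + C\<close> and \<open>m = p - A\<close> it is triangular. For
  \<open>A < B + C\<close> and \<open>m = \<lfloor>(2p - d)/2\<rfloor>\<close> an element \<open>u\<close> of the kernel splits \<open>(1 + t)\<^sup>C u\<close> as \<open>G + t\<^sup>p\<^sup>-\<^sup>A H\<close>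
  with \<open>G\<close> of degree less than \<open>p - m - A\<close>; the Wronskian of this relation is divisible by
  \<open>t\<^sup>p\<^sup>-\<^sup>A\<^sup>-\<^sup>1 (1 + t)\<^sup>C\<^sup>-\<^sup>1\<close>, which exceeds its degree, so it vanishes, and then \<open>u = 0\<close>. Summing the
  ranks gives \<open>N = Q\<^sup>2 m (2p - d - m)\<close>.\<close>

section \<open>Wronskians in one variable\<close>

lemma power_dvd_pderiv:
  fixes F :: "'a::field poly"
  assumes "q ^ n dvd F"
  shows "q ^ (n - 1) dvd pderiv F"
proof -
  obtain G where G: "F = q ^ n * G" using assms by blast
  show ?thesis
  proof (cases n)
    case (Suc k)
    have "pderiv F = q ^ n * pderiv G + (smult (of_nat (Suc k)) (q ^ k) * pderiv q) * G"
      unfolding G Suc pderiv_mult by (simp add: pderiv_power_Suc  algebra_simps del: power_Suc)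
    also have "q ^ k dvd \<dots>"
      using Suc by (intro dvd_add dvd_mult2) (auto simp: dvd_smult)
    finally show ?thesis using Suc by simp
  qed simp
qed

lemma coeff_mult_top:
  fixes F G :: "'a::comm_semiring_0 poly"
  assumes "degree F \<le> m" "degree G \<le> n"
  shows "coeff (F * G) (m + n) = coeff F m * coeff G n"
proof -
  have "coeff F i * coeff G (m + n - i) = 0" if "i \<noteq> m" "i \<le> m + n" for i
    using that assms by (cases "i < m") (auto simp: coeff_eq_0)
  then have "(\<Sum>i\<le>m + n. coeff F i * coeff G (m + n - i)) = (\<Sum>i\<in>{m}. coeff F i * coeff G (m + n - i))"
    by (intro sum.mono_neutral_right) auto
  then show ?thesis by (simp add: coeff_mult)
qed

text \<open>The operator \<open>t d/dt\<close> multiplies the n-th coefficient by n. Comparing the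
  coefficients of index \<open>degree F + degree G\<close> in \<open>F * (t G') = (t F') * G\<close>
  makes the degrees congruent modulo the characteristic, and the degree bounds turn this into
  equality.\<close>

lemma wronskian_zero_degree_eq:
  fixes F G :: "'a::field poly"
  assumes W: "F * pderiv G = pderiv F * G" and "F \<noteq> 0" "G \<noteq> 0"
    and "degree F < CHAR('a)" "degree G < CHAR('a)"
  shows "degree F = degree G"
proof -
  let ?X = "[:0, 1:] :: 'a poly"
  have *: "coeff (?X * pderiv H) n = of_nat n * coeff H n" for H :: "'a poly" and n
    by (cases n) (simp_all add: coeff_pderiv)
  have deg: "degree (?X * pderiv H) \<le> degree H" for H :: "'a poly"
    by (rule degree_le) (auto simp: * coeff_eq_0 simp del: mult_pCons_left)
  have "coeff (F * (?X * pderiv G)) (degree F + degree G)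
      = coeff ((?X * pderiv F) * G) (degree F + degree G)"
    using arg_cong[OF W, of "\<lambda>H. coeff (?X * H) (degree F + degree G)"] by (simp only: mult_ac)
  then have "(of_nat (degree G) :: 'a) = of_nat (degree F)"
    using assms(2,3) by (subst (asm) (1 2) coeff_mult_top)
      (auto simp: * deg simp del: mult_pCons_left)
  then have "[degree G = degree F] (mod CHAR('a))"
    by (simp add: of_nat_eq_iff_cong_CHAR)
  then show ?thesis using assms(4,5) by (simp add: cong_def)
qed

text \<open>In characteristic p a vanishing Wronskian only makes F/G a function of
  \<open>t^p\<close>; the degree bounds leave constants. Subtracting the multiple of G that kills
  the coefficient of F at \<open>degree G\<close> leaves an H that cannot have the degree of G,
  hence is 0.\<close>

lemma wronskian_zero_imp_proportional:
  fixes F G :: "'a::field poly"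
  assumes W: "F * pderiv G = pderiv F * G" and G: "G \<noteq> 0"
    and "degree F < CHAR('a)" "degree G < CHAR('a)"
  obtains c where "F = smult c G"
proof -
  define c where "c = coeff F (degree G) / lead_coeff G"
  define H where "H = F - smult c G"
  have "H * pderiv G = pderiv H * G"
    using W by (simp add: H_def pderiv_diff pderiv_smult algebra_simps)
  moreover have "degree H < CHAR('a)"
    using assms(3,4) by (auto simp: H_def intro!: degree_diff_less)
  moreover have "coeff H (degree G) = 0"
    using G by (simp add: H_def c_def)
  ultimately have "H = 0"
    using wronskian_zero_degree_eq[of H G] G assms(4) by (metis leading_coeff_0_iff)
  then show ?thesis using that[of c] by (simp add: H_def)
qed

lemma degree_wronskian:
  fixes F G :: "'a::field poly"
  assumes "F * pderiv G - pderiv F * G \<noteq> 0"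
  shows "degree (F * pderiv G - pderiv F * G) < degree F + degree G"
proof -
  have *: "degree (F * pderiv G) < degree F + degree G \<or> F * pderiv G = 0" for F G :: "'a poly"
  proof (cases "F = 0 \<or> pderiv G = 0")
    case False
    then have "degree G \<noteq> 0"
    proof (intro notI)
      assume "degree G = 0"
      then obtain a where "G = [:a:]" by (rule degree_eq_zeroE)
      with False show False by simp
    qed
    moreover have "degree (pderiv G) \<le> degree G - 1" by (rule degree_pderiv_le)
    ultimately show ?thesis using False by (simp add: degree_mult_eq)
  qed auto
  from *[of F G] *[of G F] show ?thesis using assms
    by (auto simp: mult.commute add.commute intro!: degree_diff_less)
qed

text \<open>The case \<open>A < B + C\<close> of the square map. In the degree count for the
  Wronskian m cancels; the choice of m serves \<open>m + A \<le> p\<close>,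
  \<open>degree F < p\<close> and the last comparison, where \<open>B \<le> A\<close> is
  used.\<close>

lemma coeff_window_eq_0_imp_0:
  fixes u :: "'a::field_gcd poly" and A B C m :: nat
  defines "p \<equiv> CHAR('a)"
  assumes "C \<le> B" "B \<le> A" "A < B + C" "A < p" "A + B + C < 2 * p"
    and m: "m = (2 * p - (A + B + C)) div 2"
    and "degree u < m"
    and zero: "\<And>s. \<lbrakk>p - m \<le> s; s < p\<rbrakk> \<Longrightarrow> coeff (monom 1 A * ([:1, 1:] ^ C * u)) s = 0"
  shows "u = 0"
proof (rule ccontr)
  assume "u \<noteq> 0"
  define F where "F = [:1, 1:] ^ C * u"
  define G where "G = poly_cutoff (p - m - A) F"
  define H where "H = poly_shift (p - A) F"
  have C: "C \<ge> 1" using assms by linarith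
  \<comment> \<open>The floor in m loses at most one unit of
    \<open>2 * p - (A + B + C)\<close>.\<close>
  have le: "2 * m + A + B + C \<le> 2 * p" "2 * p \<le> 2 * m + A + B + C + 1"
    using m assms by linarith+
  have mA: "m + A \<le> p" using le assms by linarith
  have "F \<noteq> 0" using \<open>u \<noteq> 0\<close> by (simp add: F_def)
  have degF: "degree F = C + degree u"
    using \<open>u \<noteq> 0\<close> by (simp add: F_def degree_mult_eq degree_power_eq)
  \<comment> \<open>After division by \<open>t^A\<close> the vanishing window becomes the gap
    \<open>p - m - A \<le> s < p - A\<close> in the coefficients of F; it separates the low part G
    from the high part.\<close>
  have FGH: "F = G + monom 1 (p - A) * H"
  proof (rule poly_eqI)
    fix s
    have "coeff F s = 0" if "p - m - A \<le> s" "s < p - A"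
    proof -
      have "coeff (monom 1 A * F) (s + A) = 0"
        unfolding F_def by (rule zero) (use that in linarith)+
      then show ?thesis by (simp add: coeff_monom_mult)
    qed
    then show "coeff F s = coeff (G + monom 1 (p - A) * H) s"
      using mA by (auto simp: G_def H_def coeff_poly_cutoff coeff_monom_mult coeff_poly_shift)
  qed
  have dvdF: "[:1, 1:] ^ C dvd F" by (simp add: F_def)
  have dvdX: "[:0, 1:] ^ (p - A) dvd monom 1 (p - A) * H" by (simp add: monom_altdef)
  have coprime: "coprime ([:0, 1:] ^ i) ([:1, 1:] ^ j :: 'a poly)" for i j
  proof -
    have "coprime [:0, 1:] ([:1, 1:] :: 'a poly)"
    proof (rule coprimeI)
      fix c :: "'a poly"
      assume "c dvd [:0, 1:]" "c dvd [:1, 1:]"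
      then have "c dvd [:1, 1:] - [:0, 1:]" by (rule dvd_diff[rotated])
      then show "is_unit c" by (simp add: one_pCons)
    qed
    then show ?thesis by simp
  qed
  \<comment> \<open>Otherwise \<open>t^(p - A)\<close>, being prime to \<open>1 + t\<close>, divides
    u, whose degree is below \<open>m \<le> p - A\<close>.\<close>
  have G0: "G \<noteq> 0"
  proof
    assume "G = 0"
    then have "[:0, 1:] ^ (p - A) dvd [:1, 1:] ^ C * u" using FGH dvdX F_def by simp
    then have "[:0, 1:] ^ (p - A) dvd u"
      using coprime coprime_dvd_mult_right_iff by blast
    from dvd_imp_degree_le[OF this \<open>u \<noteq> 0\<close>] have "p - A \<le> degree u"
      by (simp add: degree_power_eq)
    then show False using \<open>degree u < m\<close> mA by linarith
  qed
  have degG: "degree G < p - m - A"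
  proof -
    have "p - m - A \<noteq> 0" using G0 by (intro notI) (simp add: G_def poly_eq_iff coeff_poly_cutoff)
    moreover have "degree G \<le> p - m - A - 1"
      by (rule degree_le) (auto simp: G_def coeff_poly_cutoff)
    ultimately show ?thesis by linarith
  qed
  have W: "F * pderiv G - pderiv F * G = 0"
  proof (rule ccontr)
    let ?W = "F * pderiv G - pderiv F * G"
    assume "?W \<noteq> 0"
    have "[:1, 1:] ^ (C - 1) dvd F"
      using dvdF le_imp_power_dvd[of "C - 1" C] dvd_trans diff_le_self by blast
    then have 1: "[:1, 1:] ^ (C - 1) dvd ?W"
      by (intro dvd_diff dvd_mult2 power_dvd_pderiv dvdF)
    have "[:0, 1:] ^ (p - A - 1) dvd monom 1 (p - A) * H"
      using dvdX le_imp_power_dvd[of "p - A - 1" "p - A"] dvd_trans diff_le_self by blast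
    then have "[:0, 1:] ^ (p - A - 1) dvd
        monom 1 (p - A) * H * pderiv G - pderiv (monom 1 (p - A) * H) * G"
      by (intro dvd_diff dvd_mult2[of _ "pderiv _"] dvd_mult2[of _ "monom 1 (p - A) * H"]
          power_dvd_pderiv dvdX)
    \<comment> \<open>The terms \<open>G * G'\<close> cancel, so F may be replaced by its high part,
      which carries the factor \<open>t^(p - A)\<close>.\<close>
    also have "\<dots> = ?W"
      by (subst (1 2) FGH) (simp add: pderiv_add algebra_simps)
    finally have 2: "[:0, 1:] ^ (p - A - 1) dvd ?W" .
    have "[:0, 1:] ^ (p - A - 1) * [:1, 1:] ^ (C - 1) dvd ?W"
      by (rule divides_mult[OF 2 1 coprime])
    \<comment> \<open>The divisor has degree \<open>p - A + C - 2\<close>, while \<open>degree ?W <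
      degree F + degree G \<le> (C + m - 1) + (p - m - A - 1)\<close>, which is the same
      number.\<close>
    from dvd_imp_degree_le[OF this \<open>?W \<noteq> 0\<close>] have "(p - A - 1) + (C - 1) \<le> degree ?W"
      by (simp add: degree_power_eq degree_mult_eq)
    with degree_wronskian[OF \<open>?W \<noteq> 0\<close>] degF degG \<open>degree u < m\<close> C \<open>A < p\<close> show False
      by linarith
  qed
  have "degree F < p" "degree G < p" using degF degG \<open>degree u < m\<close> le assms by linarith+
  then obtain c where c: "F = smult c G"
    using wronskian_zero_imp_proportional[of F G thesis] W G0 p_def by auto
  \<comment> \<open>The left side has degree below \<open>p - A\<close> and the right side is
    divisible by \<open>t^(p - A)\<close>, so both vanish and \<open>F = G\<close>.\<close>
  have "smult (c - 1) G = monom 1 (p - A) * H" using FGH c by (simp add: smult_diff_left algebra_simps)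
  then have "[:0, 1:] ^ (p - A) dvd smult (c - 1) G" using dvdX by simp
  then have "c = 1"
    using dvd_imp_degree_le[of "[:0, 1:] ^ (p - A)" "smult (c - 1) G"] G0 degG
    by (cases "c = 1") (simp_all add: degree_power_eq)
  \<comment> \<open>By the choice of m this forces \<open>A + C < B\<close>, against
    \<open>B \<le> A\<close>.\<close>
  then have "C + degree u < p - m - A" using c degF degG by simp
  then show False using le assms by linarith
qed

section \<open>Ranks of coefficient windows\<close>

text \<open>Stated by coefficients, so that \<open>polys_lt 0\<close> contains exactly the zero
  polynomial, although \<open>degree 0 = 0\<close>.\<close>

definition polys_lt :: "nat \<Rightarrow> 'a::zero poly set" where
  "polys_lt m = {u. \<forall>i\<ge>m. coeff u i = 0}"

text \<open>\<open>restrict\<close> makes the values extensional functions; for finite S over a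
  finite field they lie in the finite set \<open>S \<rightarrow>\<^sub>E UNIV\<close> and can be
  counted.\<close>

definition window_map :: "nat \<Rightarrow> nat \<Rightarrow> nat set \<Rightarrow> 'a::field poly \<Rightarrow> nat \<Rightarrow> 'a" where
  "window_map A C S u = restrict (coeff (monom 1 A * ([:1, 1:] ^ C * u))) S"

lemma polys_lt_mono: "m \<le> n \<Longrightarrow> polys_lt m \<subseteq> polys_lt n"
  by (auto simp: polys_lt_def)

lemma polys_lt_diff: "u \<in> polys_lt m \<Longrightarrow> v \<in> polys_lt m \<Longrightarrow> u - v \<in> polys_lt m"
  for u :: "'a::ab_group_add poly"
  by (auto simp: polys_lt_def)

lemma polys_lt_degree: "u \<in> polys_lt m \<longleftrightarrow> u = 0 \<or> degree u < m"
proof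
  assume "u \<in> polys_lt m"
  then have "lead_coeff u = 0" if "m \<le> degree u" using that by (simp add: polys_lt_def)
  then show "u = 0 \<or> degree u < m" by fastforce
next
  assume "u = 0 \<or> degree u < m"
  then show "u \<in> polys_lt m" by (auto simp: polys_lt_def coeff_eq_0)
qed

lemma bij_betw_coeff_polys_lt:
  "bij_betw (\<lambda>u. restrict (coeff u) {..<m}) (polys_lt m) ({..<m} \<rightarrow>\<^sub>E (UNIV :: 'a::zero set))"
proof (rule bij_betw_byWitness[where f' = "\<lambda>f. Poly (map f [0..<m])"])
  show "\<forall>u\<in>polys_lt m. Poly (map (restrict (coeff u) {..<m}) [0..<m]) = u"
    by (auto simp: polys_lt_def poly_eq_iff coeff_Poly nth_default_def)
  show "\<forall>f\<in>{..<m} \<rightarrow>\<^sub>E (UNIV :: 'a set). restrict (coeff (Poly (map f [0..<m]))) {..<m} = f"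
    by (auto simp: coeff_Poly nth_default_def fun_eq_iff PiE_def extensional_def)
  show "(\<lambda>f. Poly (map f [0..<m])) ` ({..<m} \<rightarrow>\<^sub>E (UNIV :: 'a set)) \<subseteq> polys_lt m"
    by (rule image_subsetI) (simp add: polys_lt_def coeff_Poly nth_default_def)
  show "(\<lambda>u. restrict (coeff u) {..<m}) ` polys_lt m \<subseteq> {..<m} \<rightarrow>\<^sub>E (UNIV :: 'a set)"
    by (rule image_subsetI) simp
qed

lemma card_polys_lt: "card (polys_lt m :: 'a::{finite,zero} poly set) = CARD('a) ^ m"
  using bij_betw_same_card[OF bij_betw_coeff_polys_lt[of m]] by (simp add: card_PiE)

lemma window_map_eq_iff:
  "window_map A C S u = window_map A C S v \<longleftrightarrow>
    (\<forall>s\<in>S. coeff (monom 1 A * ([:1, 1:] ^ C * (u - v))) s = 0)"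
  unfolding window_map_def right_diff_distrib coeff_diff right_minus_eq
  by (auto simp: fun_eq_iff restrict_def)

lemma window_map_subset:
  "T \<subseteq> S \<Longrightarrow> window_map A C T u = restrict (window_map A C S u) T"
  by (auto simp: window_map_def fun_eq_iff)

lemma restrict_image_PiE:
  fixes S T :: "'a set"
  assumes "T \<subseteq> S"
  shows "(\<lambda>f. restrict f T) ` (S \<rightarrow>\<^sub>E UNIV) = (T \<rightarrow>\<^sub>E (UNIV :: 'b set))"
proof (intro equalityI subsetI)
  fix f :: "'a \<Rightarrow> 'b" assume "f \<in> T \<rightarrow>\<^sub>E UNIV"
  then have eq: "f = restrict (restrict f S) T"
    using assms by (auto simp: fun_eq_iff PiE_def extensional_def)
  show "f \<in> (\<lambda>f. restrict f T) ` (S \<rightarrow>\<^sub>E UNIV)"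
    by (rule image_eqI[where x = "restrict f S"], rule eq) simp
next
  fix f :: "'a \<Rightarrow> 'b" assume "f \<in> (\<lambda>f. restrict f T) ` (S \<rightarrow>\<^sub>E UNIV)"
  then obtain g where "f = restrict g T" by blast
  then show "f \<in> T \<rightarrow>\<^sub>E UNIV" by simp
qed

text \<open>One injective square map settles all n. For \<open>n < m\<close> the domain shrinks and
  the window grows, so injectivity persists; for \<open>n \<ge> m\<close> the domain grows and the
  window shrinks, so surjectivity persists.\<close>

lemma card_window_map:
  fixes A C m n p :: nat and S :: "nat set"
  assumes "m \<le> p"
    and inj: "\<And>u :: 'a::{finite,field} poly. u \<in> polys_lt m \<Longrightarrow>
      (\<And>s. \<lbrakk>p - m \<le> s; s < p\<rbrakk> \<Longrightarrow> coeff (monom 1 A * ([:1, 1:] ^ C * u)) s = 0) \<Longrightarrow> u = 0"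
    and small: "n < m \<Longrightarrow> {p - m..<p} \<subseteq> S"
    and large: "m \<le> n \<Longrightarrow> S \<subseteq> {p - m..<p}"
  shows "card (window_map A C S ` (polys_lt (Suc n) :: 'a poly set)) =
    CARD('a) ^ (if n < m then Suc n else card S)"
proof -
  let ?W = "\<lambda>S. window_map A C S :: 'a poly \<Rightarrow> _" and ?S = "{p - m..<p}"
  have inj_W: "inj_on (?W ?S) (polys_lt m)"
    using inj polys_lt_diff unfolding inj_on_def window_map_eq_iff
    by (metis atLeastLessThan_iff right_minus_eq)
  show ?thesis
  proof (cases "n < m")
    case True
    have "inj_on (?W S) (polys_lt (Suc n))"
    proof (rule inj_onI)
      fix u v :: "'a poly"
      assume "u \<in> polys_lt (Suc n)" "v \<in> polys_lt (Suc n)" "?W S u = ?W S v"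
      moreover have "?W ?S u = ?W ?S v"
        using \<open>?W S u = ?W S v\<close> window_map_subset[OF small[OF True]] by metis
      ultimately show "u = v"
        using inj_W polys_lt_mono[of "Suc n" m] True by (auto simp: inj_on_def)
    qed
    then show ?thesis using True by (simp add: card_image card_polys_lt)
  next
    case False
    \<comment> \<open>An injection between finite sets of the same size \<open>CARD('a) ^ m\<close>
      is onto.\<close>
    have "?W ?S ` polys_lt m = (?S \<rightarrow>\<^sub>E UNIV)"
    proof (rule card_subset_eq)
      show "card (?W ?S ` polys_lt m) = card (?S \<rightarrow>\<^sub>E (UNIV :: 'a set))"
        using inj_W \<open>m \<le> p\<close> by (simp add: card_image card_polys_lt card_PiE)
    qed (auto simp: window_map_def finite_PiE)
    then have "(\<lambda>f. restrict f S) ` ?W ?S ` polys_lt m = (S \<rightarrow>\<^sub>E UNIV)"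
      using restrict_image_PiE[OF large] False by simp
    moreover have "?W S ` polys_lt m = (\<lambda>f. restrict f S) ` ?W ?S ` polys_lt m"
      unfolding image_image by (intro image_cong window_map_subset large) (use False in auto)
    ultimately have "?W S ` polys_lt m = (S \<rightarrow>\<^sub>E UNIV)" by simp
    moreover have "?W S ` polys_lt m \<subseteq> ?W S ` polys_lt (Suc n)"
      using False by (intro image_mono polys_lt_mono) simp
    moreover have "?W S ` polys_lt (Suc n) \<subseteq> (S \<rightarrow>\<^sub>E UNIV)"
      by (auto simp: window_map_def)
    ultimately have "?W S ` polys_lt (Suc n) = (S \<rightarrow>\<^sub>E UNIV)" by blast
    moreover have "finite S" using False large finite_subset[of S ?S] by simp
    ultimately show ?thesis using False by (simp add: card_PiE)
  qed
qed

text \<open>The terms climb from 1 to m, stay at m and fall to 0, like the Hilbert function of a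
  complete intersection of two forms of degrees m and M. The k-th rising and the k-th falling term
  add up to m.\<close>

lemma sum_min_shift:
  fixes m M :: nat
  assumes "m \<le> M" "M + m \<le> Suc K"
  shows "(\<Sum>n<K. if n < m then Suc n else min m (M + m - 1 - n)) = m * M"
proof (cases "m = 0")
  case True
  then show ?thesis by simp
next
  case False
  let ?f = "\<lambda>n. if n < m then Suc n else min m (M + m - 1 - n)"
  have "sum ?f {..<K} = sum ?f {..<M + m - 1}"
    by (rule sum.mono_neutral_right) (use assms False in auto)
  \<comment> \<open>Index \<open>M + m - 1\<close> contributes 0; including it gives the falling
    block the same length m as the rising one.\<close>
  also have "\<dots> = sum ?f {..<M + m}"
    by (rule sum.mono_neutral_left) (use assms False in auto)
  also have "\<dots> = (sum ?f {..<m} + sum ?f {m..<M}) + sum ?f {M..<M + m}"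
  proof -
    have "{..<M + m} = {..<m} \<union> {m..<M} \<union> {M..<M + m}" using assms by auto
    moreover have "sum ?f ({..<m} \<union> {m..<M} \<union> {M..<M + m}) =
        (sum ?f {..<m} + sum ?f {m..<M}) + sum ?f {M..<M + m}"
      using assms by (subst sum.union_disjoint; simp add: sum.union_disjoint disjoint_iff)+
    ultimately show ?thesis by simp
  qed
  also have "sum ?f {m..<M} = (\<Sum>n=m..<M. m)" by (intro sum.cong) auto
  also have "\<dots> = (M - m) * m" by simp
  also have "sum ?f {M..<M + m} = (\<Sum>k<m. m - 1 - k)"
    using assms by (intro sum.reindex_bij_witness[where i = "\<lambda>k. k + M" and j = "\<lambda>n. n - M"]) auto
  also have "sum ?f {..<m} = (\<Sum>k<m. Suc k)" by (intro sum.cong) auto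
  also have "(\<Sum>k<m. Suc k) + (M - m) * m + (\<Sum>k<m. m - 1 - k) =
      (M - m) * m + (\<Sum>k<m. Suc k + (m - 1 - k))"
    unfolding sum.distrib by simp
  also have "(\<Sum>k<m. Suc k + (m - 1 - k)) = (\<Sum>k<m. m)" by (intro sum.cong) auto
  also have "(M - m) * m + \<dots> = m * M" using assms by (simp add: diff_mult_distrib algebra_simps)
  finally show ?thesis .
qed

text \<open>The least degree of a form in \<open>(x\<^sup>p, y\<^sup>p) : x\<^sup>A y\<^sup>B (x + y)\<^sup>C\<close>,
  provided that \<open>C \<le> B \<le> A < p\<close> and \<open>A + B + C < 2p\<close>.\<close>

definition initial_deg :: "nat \<Rightarrow> nat \<Rightarrow> nat \<Rightarrow> nat \<Rightarrow> nat" where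
  "initial_deg p A B C = (if B + C \<le> A then p - A else (2 * p - (A + B + C)) div 2)"

text \<open>In degree \<open>n + d\<close>, the indices \<open>s \<ge> A\<close> for which \<open>x\<^sup>s y\<^sup>n\<^sup>+\<^sup>d\<^sup>-\<^sup>s\<close> is not in \<open>(x\<^sup>p, y\<^sup>p)\<close>.\<close>

definition window :: "nat \<Rightarrow> nat \<Rightarrow> nat \<Rightarrow> nat \<Rightarrow> nat set" where
  "window p A d n = {s. A \<le> s \<and> s < p \<and> n + d < p + s}"

text \<open>For \<open>B + C \<le> A\<close> the window is \<open>A, ..., p - 1\<close>, and the
  lowest term \<open>t^k\<close> of u, with \<open>k < p - A\<close>, leaves a nonzero coefficient
  at index \<open>A + k\<close>. The other case is the Wronskian argument.\<close>

lemma window_initial_deg_injective: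
  fixes u :: "'a::field_gcd poly"
  defines "p \<equiv> CHAR('a)"
  assumes "C \<le> B" "B \<le> A" "A < p" "A + B + C < 2 * p"
    and m: "m = initial_deg p A B C" and u: "u \<in> polys_lt m"
    and zero: "\<And>s. \<lbrakk>p - m \<le> s; s < p\<rbrakk> \<Longrightarrow> coeff (monom 1 A * ([:1, 1:] ^ C * u)) s = 0"
  shows "u = 0"
proof (cases "B + C \<le> A")
  case False
  show ?thesis
  proof (rule ccontr)
    assume "u \<noteq> 0"
    then show False
      using coeff_window_eq_0_imp_0[of C B A m u] assms False
      by (simp add: initial_deg_def polys_lt_degree)
  qed
next
  case True
  have m: "m = p - A" using True m by (simp add: initial_deg_def)
  show ?thesis
  proof (rule ccontr)
    assume "u \<noteq> 0"
    then obtain k v where k: "u = monom 1 k * v" and "\<not> [:0, 1:] dvd v"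
      using order_decomp[of u 0] by (auto simp: monom_altdef)
    then have v: "coeff v 0 \<noteq> 0" by (metis dvd_iff_poly_eq_0 minus_zero poly_0_coeff_0)
    have "monom 1 A * ([:1, 1:] ^ C * u) = (monom 1 A * monom 1 k) * ([:1, 1:] ^ C * v)"
      unfolding k by (simp only: ac_simps)
    also have "\<dots> = monom 1 (A + k) * ([:1, 1:] ^ C * v)" by (simp add: mult_monom)
    finally have eq: "monom 1 A * ([:1, 1:] ^ C * u) = monom 1 (A + k) * ([:1, 1:] ^ C * v)" .
    have "coeff (monom 1 A * ([:1, 1:] ^ C * u)) (A + k) = coeff ([:1, 1:] ^ C * v) 0"
      unfolding eq by (simp add: coeff_monom_mult)
    moreover have "coeff ([:1, 1:] ^ C * v) 0 \<noteq> 0"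
      using v by (simp add: coeff_mult coeff_0_power)
    moreover have "k < m"
    proof -
      have "v \<noteq> 0" using v by auto
      then have "k \<le> degree u" unfolding k by (simp add: degree_mult_eq degree_monom_eq)
      then show ?thesis using u \<open>u \<noteq> 0\<close> by (simp add: polys_lt_degree)
    qed
    ultimately show False using zero[of "A + k"] m by simp
  qed
qed

text \<open>The rank is \<open>n + 1\<close> for \<open>n < m\<close> and the size of the window
  from m on, so the exponents form the trapezoid of \<open>sum_min_shift\<close>.\<close>

lemma prod_card_window_map:
  fixes A B C :: nat
  defines "p \<equiv> CARD('p::prime_card)" and "d \<equiv> A + B + C"
  assumes "C \<le> B" "B \<le> A" "A < p" "A + B + C < 2 * p"
    and m: "m = initial_deg p A B C"
  shows "(\<Prod>n<2 * p. card (window_map A C (window p A d n) ` (polys_lt (Suc n) :: 'p mod_ring poly set)))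
    = p ^ (m * (2 * p - d - m))"
proof -
  have cases: "m + A = p \<and> B + C \<le> A \<or> 2 * m + d \<le> 2 * p \<and> 2 * p \<le> 2 * m + d + 1 \<and> A < B + C"
    using assms(3-6) unfolding m initial_deg_def d_def by (cases "B + C \<le> A") (simp, simp, linarith)
  then have mp: "m + A \<le> p" "2 * m + d \<le> 2 * p"
    using assms(3-6) d_def by linarith+
  have dA: "d = A + B + C" and Ad: "A \<le> d" by (simp_all add: d_def)
  have *: "card (window_map A C (window p A d n) ` (polys_lt (Suc n) :: 'p mod_ring poly set)) =
      p ^ (if n < m then Suc n else min m ((2 * p - d - m) + m - 1 - n))" if "n < 2 * p" for n
  proof -
    have small: "{p - m..<p} \<subseteq> window p A d n" if "n < m"
    proof
      fix s assume "s \<in> {p - m..<p}"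
      then have "p \<le> s + m" "s < p" by auto
      moreover have "A \<le> s" using \<open>p \<le> s + m\<close> mp(1) by linarith
      moreover have "n + d < p + s" using cases \<open>p \<le> s + m\<close> that assms(3-6) d_def by linarith
      ultimately show "s \<in> window p A d n" by (simp add: window_def)
    qed
    have large: "window p A d n \<subseteq> {p - m..<p}" if "m \<le> n"
    proof
      fix s assume "s \<in> window p A d n"
      then have s: "A \<le> s" "s < p" "n + d < p + s" by (auto simp: window_def)
      then have "p \<le> s + m" using cases that by linarith
      then show "s \<in> {p - m..<p}" using s by auto
    qed
    \<comment> \<open>The \<open>+ 1\<close> turns the strict bound \<open>n + d < p + s\<close>
      into a lower bound on s, truncated to 0 when \<open>n + d < p\<close>.\<close>
    have "window p A d n = {max A (n + d + 1 - p)..<p}"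
      by (auto simp: window_def)
    then have card: "card (window p A d n) = p - max A (n + d + 1 - p)" by simp
    have "p - max A (n + d + 1 - p) = min m (2 * p - d - 1 - n)" if "m \<le> n"
    proof (cases "A \<le> n + d + 1 - p")
      case True
      have p_le: "p \<le> n + d + 1" using cases that Ad by linarith
      have "p - max A (n + d + 1 - p) = p - (n + d + 1 - p)" using True by (simp only: max.absorb2)
      also have "\<dots> = 2 * p - d - 1 - n"
        using p_le by linarith
      finally have "p - max A (n + d + 1 - p) = 2 * p - d - 1 - n" .
      moreover have "2 * p - d - 1 - n \<le> m"
        using cases True that mp by linarith
      ultimately show ?thesis by simp
    next
      case False
      then have "p - max A (n + d + 1 - p) = p - A" by (simp only: max_def if_False)
      \<comment> \<open>For \<open>n \<ge> m\<close> the lower bound A exceeds the other one only if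
        \<open>B + C \<le> A\<close>, and then the window has \<open>p - A = m\<close>
        elements.\<close>
      moreover have "m + A = p" "m \<le> 2 * p - d - 1 - n"
        using cases False that mp dA by linarith+
      ultimately show ?thesis by simp
    qed
    then have "card (window p A d n) = min m ((2 * p - d - m) + m - 1 - n)" if "m \<le> n"
      unfolding card using that mp by simp
    moreover have "card (window_map A C (window p A d n) ` (polys_lt (Suc n) :: 'p mod_ring poly set)) =
      CARD('p mod_ring) ^ (if n < m then Suc n else card (window p A d n))"
    proof (rule card_window_map[OF _ _ small large])
      show "m \<le> p" using mp by simp
    next
      fix u :: "'p mod_ring poly"
      assume "u \<in> polys_lt m" "\<And>s. \<lbrakk>p - m \<le> s; s < p\<rbrakk> \<Longrightarrow> coeff (monom 1 A * ([:1, 1:] ^ C * u)) s = 0"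
      then show "u = 0"
        using window_initial_deg_injective[of C B A m u] assms by simp
    qed
    ultimately show ?thesis by (simp add: p_def)
  qed
  have "(\<Prod>n<2 * p. card (window_map A C (window p A d n) ` (polys_lt (Suc n) :: 'p mod_ring poly set))) =
    p ^ (\<Sum>n<2 * p. if n < m then Suc n else min m ((2 * p - d - m) + m - 1 - n))"
    using * by (simp add: power_sum)
  also have "(\<Sum>n<2 * p. if n < m then Suc n else min m ((2 * p - d - m) + m - 1 - n)) = m * (2 * p - d - m)"
    using mp by (intro sum_min_shift) auto
  finally show ?thesis .
qed

section \<open>Frobenius components of bivariate polynomials\<close>

abbreviation coeff2 :: "'a::zero poly poly \<Rightarrow> nat \<Rightarrow> nat \<Rightarrow> 'a" where
  "coeff2 h i j \<equiv> coeff (coeff h j) i"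

text \<open>The ideal \<open>(x^q, y^q)\<close>, seen as the polynomials without monomials in the
  box of side q.\<close>

definition box_ideal :: "nat \<Rightarrow> 'a::zero poly poly set" where
  "box_ideal q = {h. \<forall>i<q. \<forall>j<q. coeff2 h i j = 0}"

text \<open>Writing \<open>h = \<Sum> x\<^sup>i y\<^sup>j h\<^sub>i\<^sub>j(x\<^sup>Q, y\<^sup>Q)\<close> with \<open>i, j < Q\<close>, this is the part of degree \<open>n\<close> of
  \<open>h\<^sub>i\<^sub>j\<close>, dehomogenized by \<open>y = 1\<close>.\<close>

definition component :: "nat \<Rightarrow> nat \<Rightarrow> nat \<Rightarrow> nat \<Rightarrow> 'a::comm_monoid_add poly poly \<Rightarrow> 'a poly" where
  "component Q i j n h = (\<Sum>s\<le>n. monom (coeff2 h (i + Q * s) (j + Q * (n - s))) s)"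

lemma coeff_component:
  "coeff (component Q i j n h) s = (if s \<le> n then coeff2 h (i + Q * s) (j + Q * (n - s)) else 0)"
  by (simp add: component_def coeff_sum)

lemma component_in_polys_lt: "component Q i j n h \<in> polys_lt (Suc n)"
  by (simp add: polys_lt_def coeff_component)

lemma component_add: "component Q i j n (g + h) = component Q i j n g + component Q i j n h"
  by (rule poly_eqI) (simp add: coeff_component)

lemma component_diff:
  "component Q i j n (g - h) = component Q i j n g - component Q i j n h"
  for g h :: "'a::ab_group_add poly poly"
  by (rule poly_eqI) (simp add: coeff_component)

lemma poly_x_power: "poly_x ^ k = [:monom 1 k:]"
  by (simp add: poly_x_def monom_altdef poly_const_pow)

lemma poly_y_power: "poly_y ^ k = monom 1 k"
  by (simp add: poly_y_def monom_altdef)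

lemma coeff2_poly_x_power_mult:
  "coeff2 (poly_x ^ k * h) a b = (if a < k then 0 else coeff2 h (a - k) b)"
  by (simp add: poly_x_power coeff_monom_mult)

lemma coeff2_poly_y_power_mult:
  "coeff2 (poly_y ^ k * h) a b = (if b < k then 0 else coeff2 h a (b - k))"
  by (simp add: poly_y_power coeff_monom_mult)

text \<open>On components \<open>x^Q\<close> acts as t and raises the degree by one, while
  \<open>y^Q\<close> only raises the degree because \<open>y = 1\<close>. The residues of exponents
  modulo Q do not change.\<close>

lemma component_poly_x_power_mult:
  assumes "i < Q"
  shows "component Q i j 0 (poly_x ^ Q * h) = 0"
    and "component Q i j (Suc n) (poly_x ^ Q * h) = [:0, 1:] * component Q i j n h"
proof -
  show "component Q i j 0 (poly_x ^ Q * h) = 0"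
    using assms by (simp add: component_def coeff2_poly_x_power_mult)
  show "component Q i j (Suc n) (poly_x ^ Q * h) = [:0, 1:] * component Q i j n h"
  proof (rule poly_eqI)
    fix s
    show "coeff (component Q i j (Suc n) (poly_x ^ Q * h)) s = coeff ([:0, 1:] * component Q i j n h) s"
      using assms by (cases s) (simp_all add: coeff_component coeff2_poly_x_power_mult)
  qed
qed

lemma component_poly_y_power_mult:
  assumes "j < Q"
  shows "component Q i j 0 (poly_y ^ Q * h) = 0"
    and "component Q i j (Suc n) (poly_y ^ Q * h) = component Q i j n h"
proof -
  show "component Q i j 0 (poly_y ^ Q * h) = 0"
    using assms by (simp add: component_def coeff2_poly_y_power_mult)
  show "component Q i j (Suc n) (poly_y ^ Q * h) = component Q i j n h"
  proof (rule poly_eqI)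
    fix s
    show "coeff (component Q i j (Suc n) (poly_y ^ Q * h)) s = coeff (component Q i j n h) s"
      using assms by (auto simp: coeff_component coeff2_poly_y_power_mult le_Suc_eq Suc_diff_le)
  qed
qed

lemma component_power_mult:
  fixes L :: "'a::comm_semiring_1 poly poly"
  assumes "\<And>h. component Q i j 0 (L * h) = 0"
    and "\<And>h n. component Q i j (Suc n) (L * h) = l * component Q i j n h"
  shows "component Q i j N (L ^ k * h) = (if N < k then 0 else l ^ k * component Q i j (N - k) h)"
proof (induction k arbitrary: N h)
  case (Suc k)
  have "component Q i j N (L ^ Suc k * h) = component Q i j N (L * (L ^ k * h))"
    by (simp add: mult.assoc)
  also have "\<dots> = (if N < Suc k then 0 else l ^ Suc k * component Q i j (N - Suc k) h)"
    using assms Suc.IH by (cases N) (simp_all add: mult.assoc)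
  finally show ?case .
qed simp

definition lines :: "nat \<Rightarrow> nat \<Rightarrow> nat \<Rightarrow> 'a::field poly poly" where
  "lines A B C = poly_x ^ A * poly_y ^ B * (poly_x + poly_y) ^ C"

text \<open>By Frobenius \<open>(x + y)^Q = x^Q + y^Q\<close>, which acts as \<open>1 + t\<close>.
  So multiplication by the Q-th power of \<open>lines A B C\<close> respects the residue
  classes.\<close>

lemma component_lines_mult:
  fixes h :: "'a::field poly poly"
  assumes "prime (CHAR('a))" and Q: "Q = CHAR('a) ^ k" and "i < Q" "j < Q"
  shows "component Q i j N (lines (Q * A) (Q * B) (Q * C) * h) =
    (if N < A + B + C then 0
     else monom 1 A * ([:1, 1:] ^ C * component Q i j (N - (A + B + C)) h))"
proof -
  note x = component_poly_x_power_mult[OF \<open>i < Q\<close>] and y = component_poly_y_power_mult[OF \<open>j < Q\<close>]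
  have frob: "(poly_x + poly_y) ^ Q = (poly_x ^ Q + poly_y ^ Q :: 'a poly poly)"
    unfolding Q using assms(1) by (intro freshmans_dream') (simp_all add: semiring_char_poly)
  have "lines (Q * A) (Q * B) (Q * C) * h =
      (poly_x ^ Q) ^ A * ((poly_y ^ Q) ^ B * ((poly_x ^ Q + poly_y ^ Q) ^ C * h))"
    unfolding lines_def power_mult frob by (simp only: mult.assoc)
  also have "component Q i j N \<dots> = (if N < A then 0 else [:0, 1:] ^ A *
      component Q i j (N - A) ((poly_y ^ Q) ^ B * ((poly_x ^ Q + poly_y ^ Q) ^ C * h)))"
    by (intro component_power_mult x)
  also have "component Q i j M ((poly_y ^ Q) ^ B * ((poly_x ^ Q + poly_y ^ Q) ^ C * h)) =
      (if M < B then 0 else 1 ^ B * component Q i j (M - B) ((poly_x ^ Q + poly_y ^ Q) ^ C * h))" for M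
    by (intro component_power_mult) (simp_all add: y)
  also have "component Q i j M ((poly_x ^ Q + poly_y ^ Q) ^ C * h) =
      (if M < C then 0 else [:1, 1:] ^ C * component Q i j (M - C) h)" for M
    by (intro component_power_mult) (simp_all add: distrib_right component_add x y)
  finally show ?thesis
    by (cases "N < A + B + C") (auto simp: monom_altdef add.assoc)
qed

text \<open>Division of exponents by Q with remainder cuts the box of side \<open>Q * P\<close> into
  boxes of side P, one for each pair of residues.\<close>

lemma box_ideal_component_iff:
  assumes "Q > 0"
  shows "h \<in> box_ideal (Q * P) \<longleftrightarrow>
    (\<forall>i<Q. \<forall>j<Q. \<forall>N s. s \<le> N \<longrightarrow> s < P \<longrightarrow> N - s < P \<longrightarrow> coeff (component Q i j N h) s = 0)"
    (is "?L \<longleftrightarrow> ?R")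
proof
  have bound: "i + Q * s < Q * P" if "i < Q" "s < P" for i s
  proof -
    have "i + Q * s < Q * Suc s" using that by simp
    also have "\<dots> \<le> Q * P" using that by (intro mult_le_mono2) simp
    finally show ?thesis .
  qed
  show ?R if ?L
    using that by (auto simp: coeff_component box_ideal_def bound)
  show ?L if R: ?R
    unfolding box_ideal_def
  proof (intro CollectI allI impI)
    fix a b assume "a < Q * P" "b < Q * P"
    then have "a div Q < P" "b div Q < P"
      by (simp_all add: less_mult_imp_div_less mult.commute)
    then have "coeff (component Q (a mod Q) (b mod Q) (a div Q + b div Q) h) (a div Q) = 0"
      using R assms by simp
    then show "coeff2 h a b = 0" by (simp add: coeff_component)
  qed
qed

text \<open>Put \<open>N = n + A + B + C\<close>. Coefficients at \<open>s < A\<close> vanish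
  because of the factor \<open>t^A\<close>, those at \<open>s > N\<close> by degree, and in between
  the window is the box condition. It is empty unless \<open>n < 2 * CHAR('a)\<close>, so finitely
  many n suffice.\<close>

lemma lines_mult_in_box_ideal_iff:
  fixes h :: "'a::field poly poly"
  assumes p: "prime (CHAR('a))" and Q: "Q = CHAR('a) ^ k"
  shows "lines (Q * A) (Q * B) (Q * C) * h \<in> box_ideal (Q * CHAR('a)) \<longleftrightarrow>
    (\<forall>i<Q. \<forall>j<Q. \<forall>n<2 * CHAR('a). \<forall>s\<in>window (CHAR('a)) A (A + B + C) n.
      coeff (monom 1 A * ([:1, 1:] ^ C * component Q i j n h)) s = 0)" (is "_ \<longleftrightarrow> ?R")
proof -
  let ?p = "CHAR('a)" and ?d = "A + B + C"
  let ?c = "\<lambda>i j n. monom 1 A * ([:1, 1:] ^ C * component Q i j n h)"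
  have "Q > 0" using p Q by (simp add: prime_gt_0_nat)
  have "lines (Q * A) (Q * B) (Q * C) * h \<in> box_ideal (Q * ?p) \<longleftrightarrow>
    (\<forall>i<Q. \<forall>j<Q. \<forall>N s. s \<le> N \<longrightarrow> s < ?p \<longrightarrow> N - s < ?p \<longrightarrow> ?d \<le> N \<longrightarrow> coeff (?c i j (N - ?d)) s = 0)"
    unfolding box_ideal_component_iff[OF \<open>Q > 0\<close>]
    by (auto simp: component_lines_mult[OF p Q] not_less simp del: One_nat_def)
  also have "\<dots> \<longleftrightarrow> ?R"
  proof (intro iffI allI impI ballI)
    fix i j n s
    assume L: "\<forall>i<Q. \<forall>j<Q. \<forall>N s. s \<le> N \<longrightarrow> s < ?p \<longrightarrow> N - s < ?p \<longrightarrow> ?d \<le> N \<longrightarrow> coeff (?c i j (N - ?d)) s = 0"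
      and ij: "i < Q" "j < Q" and s: "s \<in> window ?p A ?d n"
    show "coeff (?c i j n) s = 0"
    proof (cases "s \<le> n + ?d")
      case True
      have "coeff (?c i j (n + ?d - ?d)) s = 0"
        by (rule L[rule_format]) (use True s ij in \<open>auto simp: window_def\<close>)
      then show ?thesis by simp
    next
      case False
      have "degree (?c i j n) \<le> A + (C + n)"
      proof (intro order_trans[OF degree_mult_le] add_mono)
        show "degree ([:1, 1:] ^ C :: 'a poly) \<le> C" using degree_power_le[of "[:1, 1:] :: 'a poly" C] by simp
        show "degree (component Q i j n h) \<le> n"
          by (rule degree_le) (simp add: coeff_component)
      qed (simp add: degree_monom_le)
      then show ?thesis using False by (intro coeff_eq_0) simp
    qed
  next
    fix i j N s
    assume R: ?R and ij: "i < Q" "j < Q" and s: "s \<le> N" "s < ?p" "N - s < ?p" "?d \<le> N"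
    show "coeff (?c i j (N - ?d)) s = 0"
    proof (cases "A \<le> s")
      case True
      show ?thesis
        by (rule R[rule_format]) (use True ij s in \<open>auto simp: window_def\<close>)
    next
      case False
      then show ?thesis by (simp add: coeff_monom_mult)
    qed
  qed
  finally show ?thesis .
qed

section \<open>Independence of the components and the number of profiles\<close>

text \<open>Distinct triples \<open>(i, j, n)\<close> use disjoint sets of coefficients, so the
  components can be prescribed independently; \<open>Q * K\<close> bounds all exponents
  involved.\<close>

lemma exists_components:
  fixes u :: "nat \<Rightarrow> nat \<Rightarrow> nat \<Rightarrow> 'a::comm_monoid_add poly"
  assumes "\<And>i j n. i < Q \<Longrightarrow> j < Q \<Longrightarrow> n < K \<Longrightarrow> u i j n \<in> polys_lt (Suc n)"
  obtains h where "\<And>i j n. i < Q \<Longrightarrow> j < Q \<Longrightarrow> n < K \<Longrightarrow> component Q i j n h = u i j n"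
proof -
  define f where "f a b = coeff (u (a mod Q) (b mod Q) (a div Q + b div Q)) (a div Q)" for a b
  define h where "h = Poly (map (\<lambda>b. Poly (map (\<lambda>a. f a b) [0..<Q * K])) [0..<Q * K])"
  have h: "coeff2 h a b = f a b" if "a < Q * K" "b < Q * K" for a b
    using that by (simp add: h_def coeff_Poly nth_default_def)
  have "component Q i j n h = u i j n" if "i < Q" "j < Q" "n < K" for i j n
  proof (rule poly_eqI)
    fix s
    have bound: "i + Q * s < Q * K" if "i < Q" "s \<le> n" for i s
    proof -
      have "i + Q * s < Q * Suc s" using that by simp
      also have "\<dots> \<le> Q * K" using that \<open>n < K\<close> by (intro mult_le_mono2) simp
      finally show ?thesis .
    qed
    show "coeff (component Q i j n h) s = coeff (u i j n) s"
    proof (cases "s \<le> n")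
      case True
      then show ?thesis using that by (simp add: coeff_component h bound) (simp add: f_def)
    next
      case False
      then show ?thesis using assms[OF that] by (simp add: coeff_component polys_lt_def)
    qed
  qed
  then show ?thesis by (rule that)
qed

text \<open>A complete invariant of h modulo
  \<open>(x^(Q p), y^(Q p)) : lines (Q * A) (Q * B) (Q * C)\<close>, with p the characteristic;
  counting its values counts the quotient.\<close>

definition profile :: "nat \<Rightarrow> nat \<Rightarrow> nat \<Rightarrow> nat \<Rightarrow> 'a::field poly poly \<Rightarrow> nat \<times> nat \<times> nat \<Rightarrow> nat \<Rightarrow> 'a" where
  "profile Q A B C h = restrict
    (\<lambda>(i, j, n). window_map A C (window (CHAR('a)) A (A + B + C) n) (component Q i j n h))
    ({..<Q} \<times> {..<Q} \<times> {..<2 * CHAR('a)})"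

lemma profile_eq_iff:
  fixes g h :: "'a::field poly poly"
  assumes p: "prime (CHAR('a))" and Q: "Q = CHAR('a) ^ k"
  shows "profile Q A B C g = profile Q A B C h \<longleftrightarrow>
    lines (Q * A) (Q * B) (Q * C) * (g - h) \<in> box_ideal (Q * CHAR('a))"
proof -
  have "profile Q A B C g = profile Q A B C h \<longleftrightarrow>
    (\<forall>x\<in>{..<Q} \<times> {..<Q} \<times> {..<2 * CHAR('a)}. profile Q A B C g x = profile Q A B C h x)"
    by (auto simp: fun_eq_iff profile_def)
  also have "\<dots> \<longleftrightarrow> (\<forall>i<Q. \<forall>j<Q. \<forall>n<2 * CHAR('a).
      window_map A C (window (CHAR('a)) A (A + B + C) n) (component Q i j n g) =
      window_map A C (window (CHAR('a)) A (A + B + C) n) (component Q i j n h))"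
    by (auto simp: profile_def)
  also have "\<dots> \<longleftrightarrow> lines (Q * A) (Q * B) (Q * C) * (g - h) \<in> box_ideal (Q * CHAR('a))"
    unfolding lines_mult_in_box_ideal_iff[OF p Q] window_map_eq_iff component_diff ..
  finally show ?thesis .
qed

lemma range_profile:
  "range (profile Q A B C :: 'a::field poly poly \<Rightarrow> _) =
    (\<Pi>\<^sub>E (i, j, n) \<in> {..<Q} \<times> {..<Q} \<times> {..<2 * CHAR('a)}.
      window_map A C (window (CHAR('a)) A (A + B + C) n) ` polys_lt (Suc n))"
    (is "_ = Pi\<^sub>E ?I ?F")
proof (intro equalityI subsetI)
  fix f assume "f \<in> range (profile Q A B C :: 'a poly poly \<Rightarrow> _)"
  then show "f \<in> Pi\<^sub>E ?I ?F"
    by (auto simp: profile_def component_in_polys_lt)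
next
  fix f assume f: "f \<in> Pi\<^sub>E ?I ?F"
  have "\<exists>v\<in>polys_lt (Suc n). f (i, j, n) = window_map A C (window (CHAR('a)) A (A + B + C) n) v"
    if "i < Q" "j < Q" "n < 2 * CHAR('a)" for i j n
    using PiE_mem[OF f, of "(i, j, n)"] that by auto
  then obtain u where u: "u i j n \<in> polys_lt (Suc n)"
      "f (i, j, n) = window_map A C (window (CHAR('a)) A (A + B + C) n) (u i j n)"
    if "i < Q" "j < Q" "n < 2 * CHAR('a)" for i j n
    by metis
  obtain h where h: "component Q i j n h = u i j n" if "i < Q" "j < Q" "n < 2 * CHAR('a)" for i j n
    using exists_components[of Q "2 * CHAR('a)" u] u(1) by metis
  have "f = profile Q A B C h"
  proof (rule ext)
    fix x
    show "f x = profile Q A B C h x"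
    proof (cases "x \<in> ?I")
      case True
      then show ?thesis using u h by (auto simp: profile_def)
    next
      case False
      then show ?thesis using PiE_arb[OF f False] by (simp only: profile_def restrict_apply if_False)
    qed
  qed
  then show "f \<in> range (profile Q A B C)" by blast
qed

lemma card_range_profile:
  assumes "C \<le> B" "B \<le> A" "A < CARD('p)" "A + B + C < 2 * CARD('p)"
    and m: "m = initial_deg CARD('p) A B C"
  shows "card (range (profile Q A B C :: 'p::prime_card mod_ring poly poly \<Rightarrow> _)) =
    CARD('p) ^ (Q\<^sup>2 * (m * (2 * CARD('p) - (A + B + C) - m)))"
proof -
  let ?c = "\<lambda>n. card (window_map A C (window CARD('p) A (A + B + C) n) ` (polys_lt (Suc n) :: 'p mod_ring poly set))"
  have "card (range (profile Q A B C :: 'p mod_ring poly poly \<Rightarrow> _)) =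
      (\<Prod>(i, j, n) \<in> {..<Q} \<times> {..<Q} \<times> {..<2 * CARD('p)}. ?c n)"
    unfolding range_profile by (subst card_PiE) (auto simp: case_prod_unfold)
  also have "\<dots> = (\<Prod>i<Q. \<Prod>j<Q. \<Prod>n<2 * CARD('p). ?c n)"
    by (simp only: prod.cartesian_product)
  also have "\<dots> = ((CARD('p) ^ (m * (2 * CARD('p) - (A + B + C) - m))) ^ Q) ^ Q"
    using prod_card_window_map[where 'p = 'p, OF assms] by simp
  finally show ?thesis by (simp add: power2_eq_square mult_ac flip: power_mult)
qed

section \<open>Length of a finite quotient ring\<close>

lemma subgroup_add_monoid_quotient_module:
  "subgroup H (add_monoid (quotient_module R J)) \<longleftrightarrow> subgroup H (add_monoid (R Quot J))"
  by (simp add: subgroup_def m_inv_def quotient_module_def ring.defs)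

lemma smult_quotient_module:
  "module.smult (quotient_module R J) r Z = rcoset_mult R J (J +>\<^bsub>R\<^esub> r) Z"
  by (simp add: quotient_module_def ring.defs module.defs)

lemma (in ideal) a_r_coset_eq_iff:
  assumes "a \<in> carrier R" "b \<in> carrier R"
  shows "I +> a = I +> b \<longleftrightarrow> a \<ominus> b \<in> I"
  using quotient_eq_iff_same_a_r_cos[OF ideal_axioms assms] by simp

lemma (in ideal) carrier_FactRing: "carrier (R Quot I) = (+>) I ` carrier R"
  by (auto simp: FactRing_simps)

lemma (in ideal) submodule_image_ideal:
  assumes "ideal K R"
  shows "submodule ((+>) I ` K) R (quotient_module R I)"
proof -
  interpret K: ideal K R by fact
  interpret \<pi>: ring_hom_ring R "R Quot I" "(+>) I" by (rule rcos_ring_hom_ring)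
  have "subgroup ((+>) I ` K) (add_monoid (R Quot I))"
    using \<pi>.a_group_hom K.a_subgroup group_hom.subgroup_img_is_subgroup by fastforce
  moreover have "rcoset_mult R I (I +> r) Z \<in> (+>) I ` K" if r: "r \<in> carrier R" and Z: "Z \<in> (+>) I ` K" for r Z
  proof -
    obtain k where k: "k \<in> K" "Z = I +> k" using Z by blast
    have "rcoset_mult R I (I +> r) Z = I +> (r \<otimes> k)"
      unfolding k(2) by (rule rcoset_mult_add) (use r k in auto)
    then show ?thesis using K.I_l_closed[OF k(1) r] by blast
  qed
  ultimately show ?thesis
    by (simp add: submodule_def submodule_axioms_def subgroup_add_monoid_quotient_module smult_quotient_module)
qed

section \<open>Lower bound: chains of ideals built from socle elements\<close>

text \<open>Take the last power \<open>x^s'\<close> outside K, then the last product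
  \<open>x^s' y^t'\<close> outside K; both exist because x and y are nilpotent modulo K.\<close>

lemma (in cring) exists_socle_element:
  assumes K: "ideal K R" "K \<noteq> carrier R"
    and xy: "x \<in> carrier R" "y \<in> carrier R"
    and "x [^] (q::nat) \<in> K" "y [^] q \<in> K"
  obtains h where "h \<in> carrier R" "h \<notin> K" "x \<otimes> h \<in> K" "y \<otimes> h \<in> K"
proof -
  interpret K: ideal K R by fact
  have one: "\<one> \<notin> K" using K.one_imp_carrier K(2) by blast
  define s where "s = (LEAST n::nat. x [^] n \<in> K)"
  have s: "x [^] s \<in> K" unfolding s_def by (rule LeastI) (rule assms)
  then obtain s' where s': "s = Suc s'" using one by (cases s) auto
  have xs': "x [^] s' \<notin> K" using not_less_Least[of s' "\<lambda>n. x [^] n \<in> K"] s' unfolding s_def by simp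
  define t where "t = (LEAST n::nat. x [^] s' \<otimes> y [^] n \<in> K)"
  have "x [^] s' \<otimes> y [^] q \<in> K" using assms by (simp add: K.I_l_closed)
  then have t: "x [^] s' \<otimes> y [^] t \<in> K" unfolding t_def by (rule LeastI)
  then obtain t' where t': "t = Suc t'" using xs' xy by (cases t) auto
  let ?h = "x [^] s' \<otimes> y [^] t'"
  have "?h \<notin> K"
    using not_less_Least[of t' "\<lambda>n. x [^] s' \<otimes> y [^] n \<in> K"] t' unfolding t_def by simp
  moreover have "x \<otimes> ?h = x [^] s \<otimes> y [^] t'" "y \<otimes> ?h = x [^] s' \<otimes> y [^] t"
    using xy by (simp_all add: s' t' nat_pow_Suc m_ac)
  then have "x \<otimes> ?h \<in> K" "y \<otimes> ?h \<in> K"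
    using s t xy by (simp_all add: K.I_r_closed)
  moreover have "?h \<in> carrier R" using xy by simp
  ultimately show ?thesis using that by blast
qed

text \<open>For h in the socle modulo K, the class of \<open>u h\<close> modulo K depends only on
  the residue of u modulo \<open>(x, y)\<close>. So adjoining h multiplies the number of classes
  modulo J by at most the number of representatives in F.\<close>

lemma (in cring) ideal_extension_step:
  assumes J: "ideal J R" and K: "ideal K R" "K \<noteq> carrier R" "J \<subseteq> K"
    and xy: "x \<in> carrier R" "y \<in> carrier R"
    and nil: "x [^] (q::nat) \<in> K" "y [^] q \<in> K"
    and F: "finite F" "F \<subseteq> carrier R"
    and res: "\<And>u. u \<in> carrier R \<Longrightarrow>
      \<exists>c\<in>F. \<exists>a\<in>carrier R. \<exists>b\<in>carrier R. u = c \<oplus> (a \<otimes> x \<oplus> b \<otimes> y)"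
    and fin: "finite ((+>) J ` K)"
  obtains L where "ideal L R" "K \<subset> L" "card ((+>) J ` L) \<le> card F * card ((+>) J ` K)"
proof -
  interpret J: ideal J R by fact
  interpret K: ideal K R by fact
  obtain h where h: "h \<in> carrier R" "h \<notin> K" "x \<otimes> h \<in> K" "y \<otimes> h \<in> K"
    by (rule exists_socle_element[OF K(1,2) xy nil])
  define L where "L = K <+>\<^bsub>R\<^esub> PIdl h"
  have L: "ideal L R" unfolding L_def by (intro add_ideals K cgenideal_ideal h)
  have mem: "v \<in> L \<longleftrightarrow> (\<exists>k\<in>K. \<exists>u\<in>carrier R. v = k \<oplus> u \<otimes> h)" for v
    by (auto simp: L_def set_add_def' cgenideal_def)
  have "k \<in> L" if "k \<in> K" for k
    unfolding mem by (rule bexI[OF _ that], rule bexI[of _ \<zero>]) (use that h in auto)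
  moreover have "h \<in> L"
    unfolding mem by (rule bexI[of _ \<zero>], rule bexI[of _ \<one>]) (use h in auto)
  ultimately have "K \<subset> L" using h by blast
  have "(+>) J ` L \<subseteq> (\<lambda>(c, Z). Z <+>\<^bsub>R\<^esub> (J +> c \<otimes> h)) ` (F \<times> (+>) J ` K)"
  proof safe
    fix v assume "v \<in> L"
    then obtain k u where k: "k \<in> K" and u: "u \<in> carrier R" and v: "v = k \<oplus> u \<otimes> h"
      unfolding mem by blast
    obtain c a b where c: "c \<in> F" and ab: "a \<in> carrier R" "b \<in> carrier R"
      and u_eq: "u = c \<oplus> (a \<otimes> x \<oplus> b \<otimes> y)"
      using res[OF u] by blast
    have carr: "k \<in> carrier R" "c \<in> carrier R" using k c F by auto
    \<comment> \<open>\<open>a x h + b y h\<close> lies in K and is absorbed into k, leaving only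
      \<open>c h\<close>.\<close>
    define k' where "k' = k \<oplus> (a \<otimes> (x \<otimes> h) \<oplus> b \<otimes> (y \<otimes> h))"
    have k': "k' \<in> K"
      unfolding k'_def by (intro K.a_closed k K.I_l_closed h ab)
    have "v = k' \<oplus> c \<otimes> h"
      unfolding v u_eq k'_def using carr ab xy h
      by (simp add: l_distr m_assoc a_ac)
    then have "J +> v = (J +> k') <+>\<^bsub>R\<^esub> (J +> c \<otimes> h)"
      using k' carr h by (simp add: J.a_rcos_sum)
    then show "J +> v \<in> (\<lambda>(c, Z). Z <+>\<^bsub>R\<^esub> (J +> c \<otimes> h)) ` (F \<times> (+>) J ` K)"
      using c k' by (intro image_eqI[of _ _ "(c, J +> k')"]) auto
  qed
  then have "card ((+>) J ` L) \<le> card (F \<times> (+>) J ` K)"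
    using fin F by (intro surj_card_le) auto
  then have "card ((+>) J ` L) \<le> card F * card ((+>) J ` K)" by (simp add: card_cartesian_product)
  then show ?thesis using L \<open>K \<subset> L\<close> that by blast
qed

text \<open>Each step multiplies the number of classes by at most p, so after \<open>i < N\<close>
  steps fewer than \<open>p^N\<close> classes are reached and the ideal is still proper.\<close>

lemma (in cring) exists_ideal_chain:
  assumes J: "ideal J R"
    and xy: "x \<in> carrier R" "y \<in> carrier R"
    and nil: "x [^] (q::nat) \<in> J" "y [^] q \<in> J"
    and F: "finite F" "F \<subseteq> carrier R" "card F \<le> p"
    and res: "\<And>u. u \<in> carrier R \<Longrightarrow>
      \<exists>c\<in>F. \<exists>a\<in>carrier R. \<exists>b\<in>carrier R. u = c \<oplus> (a \<otimes> x \<oplus> b \<otimes> y)"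
    and fin: "finite (carrier (R Quot J))" and card: "card (carrier (R Quot J)) = p ^ N" and "1 < p"
  shows "i \<le> N \<Longrightarrow> \<exists>K. (\<forall>j\<le>i. ideal (K j) R \<and> J \<subseteq> K j \<and> card ((+>) J ` K j) \<le> p ^ j) \<and>
    (\<forall>j<i. K j \<subset> K (Suc j))"
proof (induction i)
  case 0
  interpret J: ideal J R by fact
  have "(+>) J ` J \<subseteq> {J}" using J.a_rcos_const by auto
  then have "card ((+>) J ` J) \<le> 1" using card_mono[of "{J}"] by simp
  then show ?case using J by (intro exI[of _ "\<lambda>_. J"]) simp
next
  case (Suc i)
  interpret J: ideal J R by fact
  obtain K where K: "\<forall>j\<le>i. ideal (K j) R \<and> J \<subseteq> K j \<and> card ((+>) J ` K j) \<le> p ^ j"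
    "\<forall>j<i. K j \<subset> K (Suc j)"
    using Suc by auto
  have Ki: "ideal (K i) R" "J \<subseteq> K i" "card ((+>) J ` K i) \<le> p ^ i" using K by auto
  have "p ^ i < p ^ N" using Suc.prems \<open>1 < p\<close> by simp
  then have ne: "K i \<noteq> carrier R" using Ki(3) card J.carrier_FactRing by auto
  have "finite ((+>) J ` K i)"
    using fin J.carrier_FactRing additive_subgroup.a_subset[OF ideal.axioms(1)[OF Ki(1)]]
    by (metis finite_subset image_mono)
  then obtain L where L: "ideal L R" "K i \<subset> L" "card ((+>) J ` L) \<le> card F * card ((+>) J ` K i)"
    using ideal_extension_step[OF J Ki(1) ne Ki(2) xy _ _ F(1,2) res, of q] nil Ki(2) by blast
  have "card F * card ((+>) J ` K i) \<le> p * p ^ i" by (intro mult_le_mono F Ki)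
  then have "card ((+>) J ` L) \<le> p ^ Suc i" using L(3) by simp
  then show ?case
    using K L Ki by (intro exI[of _ "K(Suc i := L)"]) (simp add: le_Suc_eq less_Suc_eq all_conj_distrib, blast)
qed

section \<open>Upper bound by Lagrange's theorem, and the length\<close>

text \<open>The orders are powers of p, and a strict inclusion raises the exponent by at least
  one.\<close>

lemma subgroup_chain_length_le:
  assumes "group G" "card (carrier G) = p ^ N" "prime (p::nat)"
    and sub: "\<And>i. i \<le> n \<Longrightarrow> subgroup (H i) G" and strict: "\<And>i. i < n \<Longrightarrow> H i \<subset> H (Suc i)"
  shows "n \<le> N"
proof -
  interpret group G by fact
  have "card (carrier G) > 0" using assms(2,3) by (simp add: prime_gt_0_nat)
  then have fin: "finite (carrier G)" by (rule card_ge_0_finite)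
  have dvd: "card (H i) dvd p ^ N" if "i \<le> n" for i
  proof
    show "p ^ N = card (H i) * card (rcosets\<^bsub>G\<^esub> H i)"
      using lagrange[OF sub[OF that]] assms(2) by (simp add: Coset.order_def mult.commute)
  qed
  have "\<exists>k\<le>N. i \<le> k \<and> card (H i) = p ^ k" if "i \<le> n" for i
    using that
  proof (induction i)
    case 0
    from dvd[OF 0] obtain k where "k \<le> N" "card (H 0) = p ^ k"
      unfolding divides_primepow_nat[OF assms(3)] by blast
    then show ?case by (intro exI[of _ k] conjI) simp_all
  next
    case (Suc i)
    obtain k where k: "k \<le> N" "i \<le> k" "card (H i) = p ^ k"
      using Suc.IH[OF Suc_leD[OF Suc.prems]] by blast
    from dvd[OF Suc.prems] obtain l where l: "l \<le> N" "card (H (Suc i)) = p ^ l"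
      unfolding divides_primepow_nat[OF assms(3)] by blast
    have "card (H i) < card (H (Suc i))"
      using strict[of i] Suc.prems sub[OF Suc.prems] fin
      by (meson Suc_le_lessD finite_subset psubset_card_mono subgroup.subset)
    then have "k < l" using k l prime_gt_1_nat[OF assms(3)] by simp
    then show ?case using k l by (intro exI[of _ l] conjI) simp_all
  qed
  from this[of n] show ?thesis by auto
qed

lemma (in cring) module_length_quotient_module:
  assumes J: "ideal J R"
    and xy: "x \<in> carrier R" "y \<in> carrier R"
    and nil: "x [^] (q::nat) \<in> J" "y [^] q \<in> J"
    and F: "finite F" "F \<subseteq> carrier R" "card F \<le> p"
    and res: "\<And>u. u \<in> carrier R \<Longrightarrow>
      \<exists>c\<in>F. \<exists>a\<in>carrier R. \<exists>b\<in>carrier R. u = c \<oplus> (a \<otimes> x \<oplus> b \<otimes> y)"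
    and card: "card (carrier (R Quot J)) = p ^ N" and p: "prime p"
  shows "module_length R (quotient_module R J) = enat N"
proof -
  interpret J: ideal J R by fact
  let ?S = "{n. \<exists>H. (\<forall>i\<le>n. submodule (H i) R (quotient_module R J)) \<and> (\<forall>i<n. H i \<subset> H (Suc i))}"
  have p1: "1 < p" using p by (rule prime_gt_1_nat)
  have fin: "finite (carrier (R Quot J))"
    using card p by (intro card_ge_0_finite) (simp add: prime_gt_0_nat)
  have "N \<in> ?S"
  proof -
    obtain K where K: "\<forall>j\<le>N. ideal (K j) R \<and> J \<subseteq> K j" "\<forall>j<N. K j \<subset> K (Suc j)"
      using exists_ideal_chain[OF J xy nil F res fin card p1 order_refl] by auto
    \<comment> \<open>Inclusions stay strict in the quotient because \<open>K j\<close> contains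
      J.\<close>
    have "(+>) J ` K j \<subset> (+>) J ` K (Suc j)" if j: "j < N" for j
    proof -
      have id: "ideal (K j) R" "ideal (K (Suc j)) R" "J \<subseteq> K j" using K(1) j by auto
      interpret Kj: ideal "K j" R by (rule id)
      interpret KSj: ideal "K (Suc j)" R by (rule id)
      obtain h where h: "h \<in> K (Suc j)" "h \<notin> K j" using K(2) j by blast
      have "J +> h \<notin> (+>) J ` K j"
      proof
        assume "J +> h \<in> (+>) J ` K j"
        then obtain k where k: "k \<in> K j" "J +> h = J +> k" by blast
        have "h \<ominus> k \<in> K j" using J.a_r_coset_eq_iff[of h k] k h id(3) by auto
        then have "(h \<ominus> k) \<oplus> k \<in> K j" using k by simp
        moreover have "(h \<ominus> k) \<oplus> k = h"
          using h(1) k(1) by (simp add: a_minus_def a_assoc l_neg)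
        ultimately show False using h by simp
      qed
      then show ?thesis using K(2) j h by blast
    qed
    then show ?thesis
      using K J.submodule_image_ideal by (intro CollectI exI[of _ "\<lambda>j. (+>) J ` K j"]) auto
  qed
  moreover have "n \<le> N" if n: "n \<in> ?S" for n
  proof -
    obtain H where "\<forall>i\<le>n. submodule (H i) R (quotient_module R J)" "\<forall>i<n. H i \<subset> H (Suc i)"
      using n unfolding mem_Collect_eq by (elim exE conjE)
    then have "\<And>i. i \<le> n \<Longrightarrow> subgroup (H i) (add_monoid (R Quot J))" "\<And>i. i < n \<Longrightarrow> H i \<subset> H (Suc i)"
      by (auto simp: submodule_def subgroup_add_monoid_quotient_module)
    moreover have "group (add_monoid (R Quot J))"
      using J.quotient_is_ring ring.is_abelian_group abelian_group.a_group by blast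
    ultimately show ?thesis
      using card p by (intro subgroup_chain_length_le[of "add_monoid (R Quot J)" p N n H]) auto
  qed
  ultimately show ?thesis
    unfolding module_length_def by (intro antisym SUP_least SUP_upper2[of N]) auto
qed

section \<open>The local ring of the plane\<close>

lemma coeff2_mult:
  "coeff2 (g * h) i j = (\<Sum>v\<le>j. \<Sum>u\<le>i. coeff2 g u v * coeff2 h (i - u) (j - v))"
  by (simp add: coeff_mult coeff_sum)

lemma box_ideal_add: "g \<in> box_ideal q \<Longrightarrow> h \<in> box_ideal q \<Longrightarrow> g + h \<in> box_ideal q"
  by (simp add: box_ideal_def)

lemma box_ideal_mult_left:
  fixes g h :: "'a::comm_semiring_0 poly poly"
  assumes "h \<in> box_ideal q"
  shows "g * h \<in> box_ideal q"
proof -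
  have "coeff2 g u v * coeff2 h (i - u) (j - v) = 0" if "i < q" "j < q" for i j u v
    using assms that by (simp add: box_ideal_def)
  then show ?thesis unfolding box_ideal_def mem_Collect_eq coeff2_mult by (intro allI impI sum.neutral ballI)
qed

lemma box_ideal_iff:
  fixes h :: "'a::field poly poly"
  shows "h \<in> box_ideal q \<longleftrightarrow> (\<exists>a b. h = poly_x ^ q * a + poly_y ^ q * b)"
proof
  assume h: "h \<in> box_ideal q"
  \<comment> \<open>Split h at y-degree q: \<open>poly_shift q h\<close> is the cofactor of
    \<open>y^q\<close>, and below that degree every coefficient is divisible by
    \<open>x^q\<close>.\<close>
  have "h = poly_x ^ q * map_poly (poly_shift q) (poly_cutoff q h) + poly_y ^ q * poly_shift q h"
  proof (intro poly_eqI)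
    fix i j
    show "coeff2 h i j = coeff2 (poly_x ^ q * map_poly (poly_shift q) (poly_cutoff q h)
        + poly_y ^ q * poly_shift q h) i j"
      using h by (simp add: coeff2_poly_x_power_mult coeff2_poly_y_power_mult coeff_map_poly
          coeff_poly_shift coeff_poly_cutoff box_ideal_def)
  qed
  then show "\<exists>a b. h = poly_x ^ q * a + poly_y ^ q * b" by blast
next
  assume "\<exists>a b. h = poly_x ^ q * a + poly_y ^ q * b"
  then show "h \<in> box_ideal q"
    by (auto simp: box_ideal_def coeff2_poly_x_power_mult coeff2_poly_y_power_mult)
qed

lemma coeff2_power_eq_0:
  fixes n :: "'a::comm_semiring_1 poly poly"
  assumes "coeff2 n 0 0 = 0"
  shows "i + j < k \<Longrightarrow> coeff2 (n ^ k) i j = 0"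
proof (induction k arbitrary: i j)
  case (Suc k)
  have "coeff2 n u v * coeff2 (n ^ k) (i - u) (j - v) = 0" if "u \<le> i" "v \<le> j" for u v
  proof (cases "u = 0 \<and> v = 0")
    case False
    then have "(i - u) + (j - v) < k" using that Suc.prems by linarith
    then show ?thesis using Suc.IH by simp
  qed (use assms in simp)
  then show ?case unfolding power_Suc coeff2_mult by simp
qed simp

text \<open>Rescale s to \<open>1 - n\<close> with n in \<open>(x, y)\<close>. All monomials in the
  box have degree below \<open>2 q\<close>, so none occurs in \<open>n^(2 q)\<close>, and the
  truncated geometric series inverts \<open>1 - n\<close>.\<close>

lemma exists_inverse_mod_box_ideal:
  fixes s :: "'a::field poly poly"
  assumes "coeff2 s 0 0 \<noteq> 0"
  obtains t where "1 - s * t \<in> box_ideal q"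
proof -
  define c where "c = [:[:inverse (coeff2 s 0 0):]:]"
  define n where "n = 1 - c * s"
  have "coeff2 n 0 0 = 0" using assms by (simp add: n_def c_def)
  then have "n ^ (2 * q) \<in> box_ideal q"
    by (simp add: box_ideal_def coeff2_power_eq_0)
  moreover have "n ^ (2 * q) = 1 - (1 - n) * (\<Sum>i<2 * q. n ^ i)"
    by (simp add: one_diff_power_eq[symmetric])
  moreover have "(1 - n) * (\<Sum>i<2 * q. n ^ i) = s * (c * (\<Sum>i<2 * q. n ^ i))"
    by (simp add: n_def mult_ac)
  ultimately show ?thesis using that by metis
qed

lemma box_ideal_cancel:
  fixes s h :: "'a::field poly poly"
  assumes "coeff2 s 0 0 \<noteq> 0" "s * h \<in> box_ideal q"
  shows "h \<in> box_ideal q"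
proof -
  obtain t where t: "1 - s * t \<in> box_ideal q" by (rule exists_inverse_mod_box_ideal[OF assms(1)])
  have "h = h * (1 - s * t) + t * (s * h)" by (simp add: algebra_simps)
  also have "\<dots> \<in> box_ideal q" by (intro box_ideal_add box_ideal_mult_left t assms(2))
  finally show ?thesis .
qed

lemma origin_ideal_iff:
  fixes h :: "'a::field poly poly"
  shows "h \<in> origin_ideal \<longleftrightarrow> coeff2 h 0 0 = 0"
proof -
  let ?R = "ring_of_type_algebra :: 'a poly poly ring"
  interpret cring ?R by (rule cring_from_type_algebra)
  have "ideal (box_ideal 1 :: 'a poly poly set) ?R"
  proof (rule idealI[OF ring_axioms])
    show "subgroup (box_ideal 1 :: 'a poly poly set) (add_monoid ?R)"
    proof (rule add.subgroupI)
      fix a :: "'a poly poly" assume "a \<in> box_ideal 1"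
      then have "- a \<in> box_ideal 1" by (simp add: box_ideal_def)
      moreover have "\<ominus>\<^bsub>?R\<^esub> a = - a"
        by (rule minus_equality) (simp_all add: ring_of_type_algebra_def)
      ultimately show "\<ominus>\<^bsub>?R\<^esub> a \<in> box_ideal 1" by simp
    next
      have "(0 :: 'a poly poly) \<in> box_ideal 1" by (simp add: box_ideal_def)
      then show "(box_ideal 1 :: 'a poly poly set) \<noteq> {}" by blast
    qed (auto simp: ring_of_type_algebra_def box_ideal_add)
  next
    fix a x :: "'a poly poly" assume "a \<in> box_ideal 1"
    then have "x * a \<in> box_ideal 1" by (rule box_ideal_mult_left)
    then show "x \<otimes>\<^bsub>?R\<^esub> a \<in> box_ideal 1" "a \<otimes>\<^bsub>?R\<^esub> x \<in> box_ideal 1"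
      by (simp_all add: ring_of_type_algebra_def mult.commute)
  qed
  then have "origin_ideal \<subseteq> (box_ideal 1 :: 'a poly poly set)"
    unfolding origin_ideal_def
    by (rule genideal_minimal) (simp add: box_ideal_def poly_x_def poly_y_def)
  moreover have "box_ideal 1 \<subseteq> (origin_ideal :: 'a poly poly set)"
  proof
    fix h :: "'a poly poly" assume "h \<in> box_ideal 1"
    then obtain a b where h: "h = poly_x * a + poly_y * b" by (auto simp: box_ideal_iff)
    interpret O: ideal "origin_ideal :: 'a poly poly set" ?R
      unfolding origin_ideal_def by (rule genideal_ideal) (simp add: ring_of_type_algebra_def)
    have "poly_x \<in> (origin_ideal :: 'a poly poly set)" "poly_y \<in> (origin_ideal :: 'a poly poly set)"
      using genideal_self[of "{poly_x, poly_y}"] by (simp_all add: origin_ideal_def ring_of_type_algebra_def)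
    then have "(a \<otimes>\<^bsub>?R\<^esub> poly_x) \<oplus>\<^bsub>?R\<^esub> (b \<otimes>\<^bsub>?R\<^esub> poly_y) \<in> origin_ideal"
      by (intro O.a_closed O.I_l_closed) (simp_all add: ring_of_type_algebra_def)
    then show "h \<in> origin_ideal" by (simp add: h ring_of_type_algebra_def mult.commute)
  qed
  ultimately have eq: "origin_ideal = (box_ideal 1 :: 'a poly poly set)" by blast
  show ?thesis unfolding eq by (simp add: box_ideal_def)
qed

section \<open>The localization as a commutative ring\<close>

lemma plane_local_ring_simps:
  "carrier plane_local_ring = {Fract g h | g h. coeff2 h 0 0 \<noteq> 0}"
  "monoid.mult plane_local_ring = (*)" "one plane_local_ring = 1"
  "zero plane_local_ring = 0" "add plane_local_ring = (+)"
  by (simp_all add: plane_local_ring_def localization_at_def ring_of_type_algebra_def origin_ideal_iff)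

lemma Fract_in_plane_local_ring: "coeff2 h 0 0 \<noteq> 0 \<Longrightarrow> Fract g h \<in> carrier plane_local_ring"
  by (auto simp: plane_local_ring_simps)

lemma cring_plane_local_ring: "cring (plane_local_ring :: 'a::field poly poly fract ring)"
proof (intro cringI abelian_groupI comm_monoidI)
  let ?R = "plane_local_ring :: 'a poly poly fract ring"
  fix u v assume "u \<in> carrier ?R" "v \<in> carrier ?R"
  then obtain a b s t where uv: "u = Fract a s" "v = Fract b t" "coeff2 s 0 0 \<noteq> 0" "coeff2 t 0 0 \<noteq> 0"
    by (auto simp: plane_local_ring_simps)
  then have "s \<noteq> 0" "t \<noteq> 0" by auto
  then have "u + v = Fract (a * t + b * s) (s * t)" "u * v = Fract (a * b) (s * t)"
    by (simp_all add: uv)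
  moreover have "coeff2 (s * t) 0 0 \<noteq> 0" using uv by (simp add: coeff2_mult)
  ultimately show "u \<oplus>\<^bsub>?R\<^esub> v \<in> carrier ?R" "u \<otimes>\<^bsub>?R\<^esub> v \<in> carrier ?R"
    unfolding plane_local_ring_simps by blast+
next
  let ?R = "plane_local_ring :: 'a poly poly fract ring"
  have "0 = Fract 0 (1 :: 'a poly poly)" "1 = Fract 1 (1 :: 'a poly poly)"
    by (simp_all add: Zero_fract_def One_fract_def)
  then show "\<zero>\<^bsub>?R\<^esub> \<in> carrier ?R" "\<one>\<^bsub>?R\<^esub> \<in> carrier ?R"
    using Fract_in_plane_local_ring[of 1 "0 :: 'a poly poly"]
      Fract_in_plane_local_ring[of 1 "1 :: 'a poly poly"] by (simp_all add: plane_local_ring_simps(3,4))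
next
  let ?R = "plane_local_ring :: 'a poly poly fract ring"
  fix u assume "u \<in> carrier ?R"
  then obtain a s where u: "u = Fract a s" "coeff2 s 0 0 \<noteq> 0"
    by (auto simp: plane_local_ring_simps)
  have "- u = Fract (- a) s" by (simp add: u(1))
  then have "- u \<in> carrier ?R" using Fract_in_plane_local_ring[OF u(2)] by metis
  then show "\<exists>v\<in>carrier ?R. v \<oplus>\<^bsub>?R\<^esub> u = \<zero>\<^bsub>?R\<^esub>"
    by (intro bexI[of _ "- u"]) (simp_all add: plane_local_ring_simps)
qed (simp_all add: plane_local_ring_simps algebra_simps)

interpretation plane: cring "plane_local_ring :: 'a::field poly poly fract ring"
  by (rule cring_plane_local_ring)

lemma plane_minus:
  "u \<in> carrier plane_local_ring \<Longrightarrow> v \<in> carrier plane_local_ring \<Longrightarrow> u \<ominus>\<^bsub>plane_local_ring\<^esub> v = u - v"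
proof -
  assume u: "u \<in> carrier plane_local_ring" and v: "v \<in> carrier plane_local_ring"
  have "\<ominus>\<^bsub>plane_local_ring\<^esub> v + v = 0"
    using plane.l_neg[OF v] by (simp add: plane_local_ring_simps)
  then have "\<ominus>\<^bsub>plane_local_ring\<^esub> v = - v" by (simp add: eq_neg_iff_add_eq_0)
  then show ?thesis by (simp add: a_minus_def plane_local_ring_simps)
qed

lemma plane_nat_pow: "u [^]\<^bsub>plane_local_ring\<^esub> (n::nat) = u ^ n"
  by (induction n) (simp_all add: plane_local_ring_simps nat_pow_def mult.commute)

lemma Fract_1_power: "Fract g 1 ^ n = Fract (g ^ n) 1"
  by (induction n) (simp_all add: One_fract_def)

lemma Fract_1_in_plane_local_ring: "Fract g 1 \<in> carrier plane_local_ring"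
  by (rule Fract_in_plane_local_ring) simp

lemma loc_power:
  "loc_x ^ q = Fract (poly_x ^ q) 1" "loc_y ^ q = Fract (poly_y ^ q) 1"
  by (simp_all add: loc_x_def loc_y_def Fract_1_power)

section \<open>Length of the colon ideal\<close>

lemma card_image_eq_if_same_fibres:
  assumes "\<And>a b. a \<in> A \<Longrightarrow> b \<in> A \<Longrightarrow> f a = f b \<longleftrightarrow> g a = g b"
  shows "card (f ` A) = card (g ` A)"
proof (rule bij_betw_same_card)
  show "bij_betw (\<lambda>y. g (inv_into A f y)) (f ` A) (g ` A)"
    unfolding bij_betw_def
  proof
    show "inj_on (\<lambda>y. g (inv_into A f y)) (f ` A)"
    proof (rule inj_onI)
      fix y z assume yz: "y \<in> f ` A" "z \<in> f ` A" "g (inv_into A f y) = g (inv_into A f z)"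
      then have "f (inv_into A f y) = f (inv_into A f z)"
        using assms inv_into_into by metis
      then show "y = z" using yz by (simp add: f_inv_into_f)
    qed
    have "g (inv_into A f (f a)) = g a" if "a \<in> A" for a
      using assms[of "inv_into A f (f a)" a] that by (simp add: f_inv_into_f inv_into_into)
    then show "(\<lambda>y. g (inv_into A f y)) ` f ` A = g ` A" by (auto simp: image_image)
  qed
qed

lemma (in cring) ideal_genideal_two:
  assumes x: "x \<in> carrier R" and y: "y \<in> carrier R"
  shows "Idl {x, y} = {x \<otimes> u \<oplus> y \<otimes> v | u v. u \<in> carrier R \<and> v \<in> carrier R}"
proof
  let ?S = "PIdl x <+>\<^bsub>R\<^esub> PIdl y"
  have S: "?S = {x \<otimes> u \<oplus> y \<otimes> v | u v. u \<in> carrier R \<and> v \<in> carrier R}"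
  proof -
    have "PIdl x = {x \<otimes> u | u. u \<in> carrier R}" "PIdl y = {y \<otimes> u | u. u \<in> carrier R}"
      unfolding cgenideal_def using m_comm[OF x] m_comm[OF y] by metis+
    then show ?thesis by (simp only: set_add_def') blast
  qed
  have "ideal ?S R" by (intro add_ideals cgenideal_ideal x y)
  moreover have "x = x \<otimes> \<one> \<oplus> y \<otimes> \<zero>" "y = x \<otimes> \<zero> \<oplus> y \<otimes> \<one>" using x y by simp_all
  then have "{x, y} \<subseteq> ?S" unfolding S by blast
  ultimately show "Idl {x, y} \<subseteq> {x \<otimes> u \<oplus> y \<otimes> v | u v. u \<in> carrier R \<and> v \<in> carrier R}"
    unfolding S[symmetric] by (rule genideal_minimal)
  interpret I: ideal "Idl {x, y}" R by (rule genideal_ideal) (use x y in simp)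
  have "x \<in> Idl {x, y}" "y \<in> Idl {x, y}" using genideal_self[of "{x, y}"] x y by simp_all
  then show "{x \<otimes> u \<oplus> y \<otimes> v | u v. u \<in> carrier R \<and> v \<in> carrier R} \<subseteq> Idl {x, y}"
    by (auto intro!: I.a_closed I.I_r_closed)
qed

lemma (in cring) ideal_colon_ideal:
  assumes "ideal I R" and g: "g \<in> carrier R"
  shows "ideal (colon_ideal R I g) R"
proof -
  interpret I: ideal I R by fact
  show ?thesis
  proof (rule idealI[OF ring_axioms])
    show "subgroup (colon_ideal R I g) (add_monoid R)"
    proof (rule add.subgroupI)
      have "\<zero> \<in> colon_ideal R I g" using g by (simp add: colon_ideal_def)
      then show "colon_ideal R I g \<noteq> {}" by blast
    qed (use g in \<open>auto simp: colon_ideal_def l_distr l_minus\<close>)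
  next
    fix a x assume a: "a \<in> colon_ideal R I g" and x: "x \<in> carrier R"
    then have "x \<otimes> (a \<otimes> g) \<in> I" "a \<in> carrier R" by (auto simp: colon_ideal_def I.I_l_closed)
    then show "x \<otimes> a \<in> colon_ideal R I g" "a \<otimes> x \<in> colon_ideal R I g"
      using g x by (simp_all add: colon_ideal_def m_assoc m_lcomm[of a x])
  qed
qed

lemma (in cring) colon_ideal_superset:
  assumes "ideal I R" and "g \<in> carrier R"
  shows "I \<subseteq> colon_ideal R I g"
proof -
  interpret I: ideal I R by fact
  show ?thesis using assms by (auto simp: colon_ideal_def I.I_r_closed)
qed

definition power_ideal :: "nat \<Rightarrow> 'a::field poly poly fract set" where
  "power_ideal q = Idl\<^bsub>plane_local_ring\<^esub> {loc_x ^ q, loc_y ^ q}"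

lemma ideal_power_ideal: "ideal (power_ideal q) plane_local_ring"
  unfolding power_ideal_def loc_power
  by (rule plane.genideal_ideal) (simp add: Fract_1_in_plane_local_ring)

lemma power_ideal_eq:
  "power_ideal q = {loc_x ^ q * u + loc_y ^ q * v | u v.
    u \<in> carrier plane_local_ring \<and> v \<in> carrier plane_local_ring}"
  using plane.ideal_genideal_two[of "loc_x ^ q" "loc_y ^ q"]
  by (simp add: power_ideal_def loc_power Fract_1_in_plane_local_ring plane_local_ring_simps(2,5))

text \<open>Extending \<open>(x^q, y^q)\<close> to the localization and contracting gives it back:
  after clearing denominators, \<open>s * t\<close> has nonzero constant term, is a unit modulo
  \<open>(x^q, y^q)\<close> and cancels.\<close>

lemma Fract_in_power_ideal_iff:
  fixes h :: "'a::field poly poly"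
  shows "Fract h 1 \<in> power_ideal q \<longleftrightarrow> h \<in> box_ideal q"
proof
  assume "h \<in> box_ideal q"
  then obtain a b where "h = poly_x ^ q * a + poly_y ^ q * b" by (auto simp: box_ideal_iff)
  then have "Fract h 1 = loc_x ^ q * Fract a 1 + loc_y ^ q * Fract b 1"
    by (simp add: loc_power)
  then show "Fract h 1 \<in> power_ideal q"
    unfolding power_ideal_eq using Fract_1_in_plane_local_ring by blast
next
  assume "Fract h 1 \<in> power_ideal q"
  then obtain u v where uv: "u \<in> carrier plane_local_ring" "v \<in> carrier plane_local_ring"
    "Fract h 1 = loc_x ^ q * u + loc_y ^ q * v"
    unfolding power_ideal_eq by blast
  then obtain a s b t where st: "u = Fract a s" "v = Fract b t" "coeff2 s 0 0 \<noteq> 0" "coeff2 t 0 0 \<noteq> 0"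
    by (auto simp: plane_local_ring_simps)
  then have "s \<noteq> 0" "t \<noteq> 0" by auto
  then have "(s * t) * h = poly_x ^ q * (a * t) + poly_y ^ q * (b * s)"
    using uv(3) by (simp add: st loc_power eq_fract algebra_simps)
  then have "(s * t) * h \<in> box_ideal q" unfolding box_ideal_iff by blast
  moreover have "coeff2 (s * t) 0 0 \<noteq> 0" using st by (simp add: coeff2_mult)
  ultimately show "h \<in> box_ideal q" by (rule box_ideal_cancel[rotated])
qed

text \<open>Denominators are already invertible modulo \<open>(x^q, y^q)\<close>, so localizing adds
  no new classes.\<close>

lemma exists_polynomial_representative:
  fixes u :: "'a::field poly poly fract"
  assumes "u \<in> carrier plane_local_ring"
  obtains h where "u - Fract h 1 \<in> power_ideal q"
proof -
  interpret I: ideal "power_ideal q :: 'a poly poly fract set" plane_local_ring by (rule ideal_power_ideal)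
  obtain a s where u: "u = Fract a s" "coeff2 s 0 0 \<noteq> 0"
    using assms by (auto simp: plane_local_ring_simps)
  obtain t where "1 - s * t \<in> box_ideal q" by (rule exists_inverse_mod_box_ideal[OF u(2)])
  then have "u * Fract (1 - s * t) 1 \<in> power_ideal q"
    using I.I_l_closed[OF _ assms, of "Fract (1 - s * t) 1"]
    by (simp add: Fract_in_power_ideal_iff plane_local_ring_simps(2))
  moreover have "s \<noteq> 0" using u by auto
  then have "u * Fract (1 - s * t) 1 = u - Fract (a * t) 1"
    by (simp add: u eq_fract algebra_simps)
  ultimately show ?thesis using that by metis
qed

text \<open>The constants represent the residue field; c is the value of u at the origin.\<close>

lemma plane_residue:
  fixes u :: "'a::field poly poly fract"
  assumes "u \<in> carrier plane_local_ring"
  obtains c v w where "v \<in> carrier plane_local_ring" "w \<in> carrier plane_local_ring"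
    "u = Fract [:[:c:]:] 1 + (v * loc_x + w * loc_y)"
proof -
  obtain g s where u: "u = Fract g s" "coeff2 s 0 0 \<noteq> 0"
    using assms by (auto simp: plane_local_ring_simps)
  then have s: "s \<noteq> 0" by auto
  define c where "c = coeff2 g 0 0 / coeff2 s 0 0"
  have "g - [:[:c:]:] * s \<in> box_ideal 1"
    using u(2) by (simp add: box_ideal_def c_def)
  then obtain a b where "g - [:[:c:]:] * s = poly_x * a + poly_y * b" by (auto simp: box_ideal_iff)
  then have g: "g = [:[:c:]:] * s + (poly_x * a + poly_y * b)" by (simp add: algebra_simps)
  have "u = Fract [:[:c:]:] 1 + (Fract a s * loc_x + Fract b s * loc_y)"
    unfolding u(1) g using s by (simp add: loc_x_def loc_y_def eq_fract algebra_simps)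
  then show ?thesis using that Fract_in_plane_local_ring[OF u(2)] by blast
qed

text \<open>Every class modulo J has a polynomial representative, and two polynomials agree modulo J
  exactly if their profiles do. So the quotient has as many elements as there are profiles.\<close>

lemma module_length_colon_power_ideal:
  fixes A B C k :: nat
  defines "p \<equiv> CARD('p::prime_card)" and "d \<equiv> A + B + C"
  assumes ABC: "C \<le> B" "B \<le> A" "A < p" "A + B + C < 2 * p"
    and m: "m = initial_deg p A B C" and Q: "Q = p ^ k"
  defines "g \<equiv> Fract (lines (Q * A) (Q * B) (Q * C)) 1 :: 'p mod_ring poly poly fract"
  shows "module_length plane_local_ring
      (quotient_module plane_local_ring (colon_ideal plane_local_ring (power_ideal (Q * p)) g)) =
    enat (Q\<^sup>2 * (m * (2 * p - d - m)))"
proof -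
  let ?R = "plane_local_ring :: 'p mod_ring poly poly fract ring"
  let ?I = "power_ideal (Q * p) :: 'p mod_ring poly poly fract set"
  define J where "J = colon_ideal ?R ?I g"
  interpret I: ideal ?I ?R by (rule ideal_power_ideal)
  have g: "g \<in> carrier ?R" unfolding g_def by (rule Fract_1_in_plane_local_ring)
  interpret J: ideal J ?R unfolding J_def by (rule plane.ideal_colon_ideal[OF ideal_power_ideal g])
  have IJ: "?I \<subseteq> J" unfolding J_def by (rule plane.colon_ideal_superset[OF ideal_power_ideal g])
  have char: "CHAR('p mod_ring) = p" by (simp add: p_def)
  have prime: "prime p" unfolding p_def by (rule prime_card)
  have mem_J: "Fract h 1 \<in> J \<longleftrightarrow> lines (Q * A) (Q * B) (Q * C) * h \<in> box_ideal (Q * p)" for h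
  proof -
    have "Fract h 1 \<in> J \<longleftrightarrow> Fract h 1 * g \<in> ?I"
      by (simp only: J_def colon_ideal_def mem_Collect_eq Fract_1_in_plane_local_ring
          plane_local_ring_simps(2) simp_thms)
    also have "Fract h 1 * g = Fract (lines (Q * A) (Q * B) (Q * C) * h) 1"
      unfolding g_def mult_fract by (simp only: mult.commute mult_1)
    finally show ?thesis by (simp only: Fract_in_power_ideal_iff)
  qed
  let ?\<pi> = "\<lambda>h. J +>\<^bsub>?R\<^esub> Fract h 1"
  have \<pi>_eq: "?\<pi> h = ?\<pi> h' \<longleftrightarrow> profile Q A B C h = profile Q A B C h'" for h h'
  proof -
    have "?\<pi> h = ?\<pi> h' \<longleftrightarrow> Fract (h - h') 1 \<in> J"
      by (simp add: J.a_r_coset_eq_iff Fract_1_in_plane_local_ring plane_minus)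
    also have "\<dots> \<longleftrightarrow> profile Q A B C h = profile Q A B C h'"
      unfolding mem_J using profile_eq_iff[of Q k A B C h h', unfolded char] prime Q by simp
    finally show ?thesis .
  qed
  have "carrier (?R Quot J) = range ?\<pi>"
  proof -
    have "J +>\<^bsub>?R\<^esub> u \<in> range ?\<pi>" if u: "u \<in> carrier ?R" for u
    proof -
      obtain h where "u - Fract h 1 \<in> ?I" by (rule exists_polynomial_representative[OF u])
      then have "u \<ominus>\<^bsub>?R\<^esub> Fract h 1 \<in> J"
        unfolding plane_minus[OF u Fract_1_in_plane_local_ring] using IJ by blast
      then have "J +>\<^bsub>?R\<^esub> u = ?\<pi> h"
        unfolding J.a_r_coset_eq_iff[OF u Fract_1_in_plane_local_ring] .
      then show ?thesis by blast
    qed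
    then show ?thesis
      unfolding J.carrier_FactRing using Fract_1_in_plane_local_ring by blast
  qed
  then have "card (carrier (?R Quot J)) = card (range ?\<pi>)" by (rule arg_cong)
  also have "\<dots> = card (range (profile Q A B C :: 'p mod_ring poly poly \<Rightarrow> _))"
    by (rule card_image_eq_if_same_fibres) (rule \<pi>_eq)
  also have "\<dots> = p ^ (Q\<^sup>2 * (m * (2 * p - d - m)))"
    unfolding p_def d_def by (rule card_range_profile) (use ABC m in \<open>simp_all add: p_def\<close>)
  finally have card: "card (carrier (?R Quot J)) = p ^ (Q\<^sup>2 * (m * (2 * p - d - m)))" .
  let ?F = "range (\<lambda>c. Fract [:[:c:]:] 1) :: 'p mod_ring poly poly fract set"
  have "module_length ?R (quotient_module ?R J) = enat (Q\<^sup>2 * (m * (2 * p - d - m)))"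
  proof (rule plane.module_length_quotient_module[OF J.ideal_axioms, of loc_x loc_y "Q * p" ?F p])
    show "loc_x \<in> carrier ?R" "loc_y \<in> carrier ?R"
      by (simp_all add: loc_x_def loc_y_def Fract_1_in_plane_local_ring)
    have "{loc_x ^ (Q * p), loc_y ^ (Q * p)} \<subseteq> ?I"
      unfolding power_ideal_def loc_power
      by (rule plane.genideal_self) (simp add: Fract_1_in_plane_local_ring)
    then show "loc_x [^]\<^bsub>?R\<^esub> (Q * p) \<in> J" "loc_y [^]\<^bsub>?R\<^esub> (Q * p) \<in> J"
      using IJ by (auto simp: plane_nat_pow)
    show "?F \<subseteq> carrier ?R" using Fract_1_in_plane_local_ring by blast
    have "card ?F \<le> card (UNIV :: 'p mod_ring set)" by (rule card_image_le) (rule finite)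
    then show "card ?F \<le> p" by (simp only: p_def CARD_mod_ring)
    show "finite ?F" by (rule finite_imageI) (rule finite)
    fix u assume "u \<in> carrier ?R"
    then obtain c v w where "v \<in> carrier ?R" "w \<in> carrier ?R" "u = Fract [:[:c:]:] 1 + (v * loc_x + w * loc_y)"
      by (rule plane_residue)
    then show "\<exists>c\<in>?F. \<exists>v\<in>carrier ?R. \<exists>w\<in>carrier ?R.
        u = c \<oplus>\<^bsub>?R\<^esub> (v \<otimes>\<^bsub>?R\<^esub> loc_x \<oplus>\<^bsub>?R\<^esub> w \<otimes>\<^bsub>?R\<^esub> loc_y)"
      unfolding plane_local_ring_simps(2,5) by (intro bexI[of _ "Fract [:[:c:]:] 1"] bexI[of _ v] bexI[of _ w]) simp_all
    qed (rule card prime)+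
  then show ?thesis by (simp add: J_def)
qed

section \<open>The F-signature\<close>

lemma lines_power: "lines A B C ^ n = lines (n * A) (n * B) (n * C)"
  by (simp add: lines_def power_mult_distrib mult.commute[of n] flip: power_mult)

text \<open>For \<open>A < B + C\<close> the factors are the floor and the ceiling of
  \<open>p - d/2\<close>, with product \<open>p^2 - d p\<close> plus the floor of
  \<open>d^2/4\<close>; otherwise they are \<open>p - A\<close> and
  \<open>p - (B + C)\<close>.\<close>

lemma initial_deg_mult_complement:
  fixes A B C p :: nat
  defines "d \<equiv> A + B + C" and "m \<equiv> initial_deg p A B C"
  assumes "A < p" "B \<le> A" "A + B + C < 2 * p"
  shows "real (m * (2 * p - d - m)) =
    (if B + C \<le> A then (real p - real A) * (real p - real B - real C)
     else (real p)\<^sup>2 - real d * real p + real_of_int \<lfloor>(real d)\<^sup>2 / 4\<rfloor>)"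
proof (cases "B + C \<le> A")
  case True
  then have "m = p - A" "2 * p - d - m = p - (B + C)"
    using assms by (simp_all add: initial_deg_def d_def m_def)
  then show ?thesis using True assms(3) by (simp add: of_nat_diff)
next
  case False
  define t where "t = d div 2"
  have t: "d = 2 * t \<or> d = 2 * t + 1" unfolding t_def by linarith
  have "d < 2 * p" using assms by simp
  have m: "m = (2 * p - d) div 2" using False by (simp add: m_def initial_deg_def d_def)
  from t show ?thesis
  proof
    assume d: "d = 2 * t"
    then have "m = p - t" "2 * p - d - m = p - t" "t \<le> p" using m \<open>d < 2 * p\<close> by simp_all
    then have "real (m * (2 * p - d - m)) = (real p - real t) * (real p - real t)"
      by (simp only: of_nat_mult of_nat_diff)
    moreover have "\<lfloor>(real d)\<^sup>2 / 4\<rfloor> = int (t\<^sup>2)"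
      by (rule floor_unique) (simp_all add: d power2_eq_square)
    ultimately show ?thesis using False by (simp add: d power2_eq_square algebra_simps)
  next
    assume d: "d = 2 * t + 1"
    then have tp: "t + 1 \<le> p" using \<open>d < 2 * p\<close> by linarith
    have "2 * p - d = 2 * (p - t - 1) + 1" using d tp by simp
    then have "m = p - (t + 1)" "2 * p - d - m = p - t" unfolding m using tp by simp_all
    then have "real (m * (2 * p - d - m)) = (real p - real (t + 1)) * (real p - real t)"
      using tp by (simp only: of_nat_mult of_nat_diff add_leD1)
    \<comment> \<open>For odd d, \<open>d^2/4 = t^2 + t + 1/4\<close>, and the floor drops the
      quarter.\<close>
    moreover have "\<lfloor>(real d)\<^sup>2 / 4\<rfloor> = int (t\<^sup>2 + t)"
      by (rule floor_unique) (simp_all add: d power2_eq_square field_simps)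
    ultimately show ?thesis using False by (simp add: d power2_eq_square algebra_simps)
  qed
qed

text \<open>The sequence is constant from \<open>e = 1\<close> on: for \<open>e = k + 1\<close> the
  exponent \<open>n * p^k\<close> is an integer, so the ceiling has no effect, and the factor
  \<open>Q^2\<close> of the length cancels against \<open>p^(2 e)\<close>, leaving
  \<open>p^2\<close>.\<close>

lemma F_signature_seq_Suc:
  fixes a b c n :: nat
  defines "p \<equiv> CARD('p::prime_card)"
  assumes "c \<le> b" "b \<le> a" "a * n < p" "(a + b + c) * n < 2 * p"
    and f: "f = (loc_x ^ a * loc_y ^ b * (loc_x + loc_y) ^ c :: 'p mod_ring poly poly fract)"
    and m: "m = initial_deg p (a * n) (b * n) (c * n)"
  shows "F_signature_seq f (real n / real p) (Suc k) =
    ereal (real (m * (2 * p - (a * n + b * n + c * n) - m)) / (real p)\<^sup>2)"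
proof -
  let ?N = "m * (2 * p - (a * n + b * n + c * n) - m)"
  have p0: "p > 0" by (simp add: p_def)
  define Q where "Q = p ^ k"
  have "real n / real p * real p ^ Suc k = real (n * Q)" using p0 by (simp add: Q_def)
  then have exponent: "nat \<lceil>real n / real p * real p ^ Suc k\<rceil> = n * Q" by (simp only: ceiling_of_nat nat_int)
  have "f = Fract (lines a b c) 1"
    unfolding f loc_power by (simp add: loc_x_def loc_y_def lines_def Fract_1_power)
  then have "f ^ (n * Q) = Fract (lines (Q * (a * n)) (Q * (b * n)) (Q * (c * n))) 1"
    by (simp add: Fract_1_power lines_power mult_ac)
  then have "module_length plane_local_ring (quotient_module plane_local_ring
      (colon_ideal plane_local_ring (power_ideal (Q * p)) (f ^ (n * Q)))) = enat (Q\<^sup>2 * ?N)"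
    using module_length_colon_power_ideal[where 'p = 'p, of "c * n" "b * n" "a * n" m Q k] assms Q_def
    by (simp add: algebra_simps)
  then have "F_signature_seq f (real n / real p) (Suc k) =
      ereal_of_enat (enat (Q\<^sup>2 * ?N)) / ereal (real p ^ (2 * Suc k))"
    unfolding F_signature_seq_def Let_def p_def[symmetric] exponent
    by (simp only: power_ideal_def Q_def power_Suc2)
  also have "real p ^ (2 * Suc k) = (real Q)\<^sup>2 * (real p)\<^sup>2"
    by (simp add: Q_def power2_eq_square mult_2 power_add)
  also have "ereal_of_enat (enat (Q\<^sup>2 * ?N)) / ereal ((real Q)\<^sup>2 * (real p)\<^sup>2) =
      ereal (real ?N / (real p)\<^sup>2)"
    using p0 by (simp add: Q_def)
  finally show ?thesis .
qed

theorem mainTheorem4: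
  fixes a b c p :: nat
    and r :: int
    and f :: "'p::prime_card mod_ring poly poly fract"
    and \<psi> :: "real \<Rightarrow> ereal"
  assumes "a \<ge> b" and "b \<ge> c" and "a \<ge> 1"
    and "p = CARD('p)"
    and "f = loc_x ^ a * loc_y ^ b * (loc_x + loc_y) ^ c"
    and "\<psi> = (\<lambda>t. F_signature f t)"
    and "0 < real_of_int r / real p"
    and "real_of_int r / real p < min (1 / real a) (2 / real (a + b + c))"
  shows "convergent (F_signature_seq f (real_of_int r / real p)) \<and>
    \<psi> (real_of_int r / real p) = ereal
      (if a \<ge> b + c
       then 1 - real (a + b + c) * (real_of_int r / real p)
              + real (a * (b + c)) * ((real_of_int r)\<^sup>2 / (real p)\<^sup>2)
       else 1 - real (a + b + c) * (real_of_int r / real p)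
              + 1 / (real p)\<^sup>2
                * real_of_int \<lfloor>(real (a + b + c))\<^sup>2 * (real_of_int r)\<^sup>2 / 4\<rfloor>)"
proof -
  have p0: "real p > 0" using assms(4) by simp
  have "r > 0" using assms(7) p0 by (simp add: zero_less_divide_iff)
  define n where "n = nat r"
  have r: "real_of_int r = real n" and n0: "n > 0" using \<open>r > 0\<close> by (simp_all add: n_def)
  \<comment> \<open>The two terms of the minimum yield \<open>A < p\<close> and
    \<open>A + B + C < 2 p\<close> for \<open>A = a r\<close>, \<open>B = b r\<close>,
    \<open>C = c r\<close>.\<close>
  have "real (a * n) < real p"
    using assms(3,8) p0 by (simp add: r field_simps)
  then have an: "a * n < p" by (simp only: of_nat_less_iff)
  have "real ((a + b + c) * n) < real (2 * p)"
    using assms(3,8) p0 by (simp add: r field_simps)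
  then have dn: "(a + b + c) * n < 2 * p" by (simp only: of_nat_less_iff)
  define m where "m = initial_deg p (a * n) (b * n) (c * n)"
  define L where "L = real (m * (2 * p - (a * n + b * n + c * n) - m)) / (real p)\<^sup>2"
  have "F_signature_seq f (real n / real p) (Suc k) = ereal L" for k
    using F_signature_seq_Suc[where 'p = 'p, of c b a n f m k] assms(1,2,4,5) an dn
    by (simp add: m_def L_def)
  then have "(\<lambda>k. F_signature_seq f (real n / real p) (Suc k)) \<longlonglongrightarrow> ereal L" by simp
  \<comment> \<open>The term at \<open>e = 0\<close> is not covered by the formula, but the limit
    ignores it.\<close>
  then have lim: "F_signature_seq f (real n / real p) \<longlonglongrightarrow> ereal L"
    by (simp only: filterlim_sequentially_Suc)
  \<comment> \<open>Cancelling \<open>n > 0\<close> turns the case split on A, B, C into the one on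
    a, b, c.\<close>
  have cases: "b * n + c * n \<le> a * n \<longleftrightarrow> b + c \<le> a"
    using n0 by (simp flip: distrib_right)
  have "L = (if b + c \<le> a then (real p - real (a * n)) * (real p - real (b * n) - real (c * n))
     else (real p)\<^sup>2 - real (a * n + b * n + c * n) * real p
       + real_of_int \<lfloor>(real (a * n + b * n + c * n))\<^sup>2 / 4\<rfloor>) / (real p)\<^sup>2"
    unfolding L_def m_def cases[symmetric]
    by (subst initial_deg_mult_complement) (use an dn assms(1) in \<open>simp_all add: algebra_simps\<close>)
  also have "(real (a * n + b * n + c * n))\<^sup>2 = (real (a + b + c))\<^sup>2 * (real n)\<^sup>2"
    by (simp add: algebra_simps flip: power_mult_distrib)
  also have "(if b + c \<le> a then (real p - real (a * n)) * (real p - real (b * n) - real (c * n))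
     else (real p)\<^sup>2 - real (a * n + b * n + c * n) * real p
       + real_of_int \<lfloor>(real (a + b + c))\<^sup>2 * (real n)\<^sup>2 / 4\<rfloor>) / (real p)\<^sup>2 =
    (if a \<ge> b + c
       then 1 - real (a + b + c) * (real n / real p)
              + real (a * (b + c)) * ((real n)\<^sup>2 / (real p)\<^sup>2)
       else 1 - real (a + b + c) * (real n / real p)
              + 1 / (real p)\<^sup>2
                * real_of_int \<lfloor>(real (a + b + c))\<^sup>2 * (real n)\<^sup>2 / 4\<rfloor>)"
    using p0 by (simp add: field_simps power2_eq_square)
  finally show ?thesis
    using lim limI[OF lim] unfolding r assms(6) F_signature_def by (auto simp: convergent_def)
qed

end
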